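(* Let $0\le q\in L_1^{loc}(\mathbb{R})$ and assume there is $a\in(0,\infty)$ with $\inf_{x\in\mathbb{R}}\int_{x-a}^{x+a}q(t)\,dt>0$. For $p=1$ the solutions of $-y'+qy=f$ do not tend in whole to zero as $|x|\to\infty$. For $p\in(1,\infty]$ the solutions tend in whole to zero as $|x|\to\infty$ if and only if one of the following equivalent conditions holds: $$\lim_{|x|\to\infty}\int_{x-b}^{x+b}q(t)\,dt=\infty\ \text{ for all } b\in(0,\infty),\qquad\text{or}\qquad \lim_{|x|\to\infty}d(x)=0.$$
   Context: $d(x)=\inf\{d>0:\int_{x-d}^{x+d}q(t)\,dt=2\}$. $L_\infty(\mathbb{R})$ denotes $C(\mathbb{R})$ with the sup norm. $D_p$ is the set of all solutions $y\in L_p(\mathbb{R})$ (absolutely continuous, satisfying the equation a.e.) of $-y'(x)+q(x)y(x)=f(x)$, $x\in\mathbb{R}$, with $f\in L_p(\mathbb{R})$, $\|f\|_p=1$. The solutions tend in whole to zero as $|x|\to\infty$ if for every $\varepsilon>0$ there is $x_0(\varepsilon)$ such that $|y(x)|\le\varepsilon$ for all $y\in D_p$ and all $|x|\ge x_0(\varepsilon)$. *)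

theory Defs
  imports "HOL-Analysis.Analysis"
begin

definition abs_cont_on :: "real \<Rightarrow> real \<Rightarrow> (real \<Rightarrow> real) \<Rightarrow> bool" where
  "abs_cont_on c d y \<longleftrightarrow>
     (\<forall>\<epsilon>>0. \<exists>\<delta>>0. \<forall>(n::nat) (a::nat \<Rightarrow> real) (b::nat \<Rightarrow> real).
        (\<forall>i<n. c \<le> a i \<and> a i \<le> b i \<and> b i \<le> d) \<and>
        (\<forall>i<n. \<forall>j<n. i \<noteq> j \<longrightarrow> b i \<le> a j \<or> b j \<le> a i) \<and>
        (\<Sum>i<n. b i - a i) < \<delta>
        \<longrightarrow> (\<Sum>i<n. \<bar>y (b i) - y (a i)\<bar>) < \<epsilon>)"

definition loc_abs_cont :: "(real \<Rightarrow> real) \<Rightarrow> bool" where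
  "loc_abs_cont y \<longleftrightarrow> (\<forall>c d. abs_cont_on c d y)"

text \<open>Membership in L_p(R) for p in [1,\<infinity>); for p = \<infinity> the space is C(R)
  with the sup norm (bounded continuous functions), as in the paper.\<close>
definition in_Lp :: "ereal \<Rightarrow> (real \<Rightarrow> real) \<Rightarrow> bool" where
  "in_Lp p f \<longleftrightarrow>
     (if p = \<infinity> then continuous_on UNIV f \<and> bounded (range f)
      else f \<in> borel_measurable lborel \<and> integrable lborel (\<lambda>x. \<bar>f x\<bar> powr real_of_ereal p))"

definition Lp_norm :: "ereal \<Rightarrow> (real \<Rightarrow> real) \<Rightarrow> real" where
  "Lp_norm p f =
     (if p = \<infinity> then (SUP x. \<bar>f x\<bar>)
      else (\<integral>x. \<bar>f x\<bar> powr real_of_ereal p \<partial>lborel) powr (1 / real_of_ereal p))"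

definition loc_integrable :: "(real \<Rightarrow> real) \<Rightarrow> bool" where
  "loc_integrable q \<longleftrightarrow> (\<forall>a b. set_integrable lborel {a..b} q)"

definition Dp :: "ereal \<Rightarrow> (real \<Rightarrow> real) \<Rightarrow> (real \<Rightarrow> real) set" where
  "Dp p q = {y. in_Lp p y \<and> loc_abs_cont y \<and>
      (\<exists>f. in_Lp p f \<and> Lp_norm p f = 1 \<and>
           (AE x in lborel. ((y has_real_derivative (q x * y x - f x)) (at x))))}"

definition tend_in_whole_to_zero :: "ereal \<Rightarrow> (real \<Rightarrow> real) \<Rightarrow> bool" where
  "tend_in_whole_to_zero p q \<longleftrightarrow>
     (\<forall>\<epsilon>>0. \<exists>x0. \<forall>y\<in>Dp p q. \<forall>x. \<bar>x\<bar> \<ge> x0 \<longrightarrow> \<bar>y x\<bar> \<le> \<epsilon>)"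

definition dfun :: "(real \<Rightarrow> real) \<Rightarrow> real \<Rightarrow> real" where
  "dfun q x = Inf {d. d > 0 \<and> (LINT t:{x-d..x+d}|lborel. q t) = 2}"

end

theory Submission
  imports Defs
begin

text \<open>
  Let \<open>Q\<close> be a primitive of \<open>q\<close>. Since \<open>y exp (- Q)\<close> has derivative \<open>- f exp (- Q)\<close> almost
  everywhere, a solution that does not blow up satisfies
  \<open>y x = \<integral> exp (Q x - Q t) f t dt\<close>, integrated over \<open>t > x\<close>. The hypothesis on \<open>q\<close> makes \<open>Q\<close> grow
  at least linearly, so the integral of the kernel is uniformly bounded; it tends to zero
  when the windows of \<open>q\<close> tend to infinity, since then \<open>Q\<close> gains an arbitrarily large amount
  right after \<open>x\<close>. For \<open>p > 1\<close> the right-hand side is, up to a part that is small in \<open>L\<^sub>1\<close>,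
  bounded by a constant independent of \<open>f\<close>; this replaces the inequality of Hoelder.

  Conversely, if \<open>q\<close> has integral at most \<open>K\<close> over \<open>[s - b, s + b]\<close>, then
  \<open>exp (Q - Q s) \<psi>\<close> with a bump \<open>\<psi>\<close> supported in that interval solves the equation with the
  continuous right-hand side \<open>- exp (Q - Q s) \<psi>'\<close>, whose norm is at most
  \<open>exp K (4 / b) (2 b) powr (1 / p)\<close>. For \<open>p = 1\<close> this bound does not depend on \<open>b\<close>, and a
  small \<open>b\<close> makes \<open>K = 1\<close> admissible.
\<close>

section \<open>Absolutely continuous functions\<close>

lemma abs_cont_onD:
  assumes "abs_cont_on c d y" "\<epsilon> > 0"
  shows "\<exists>\<delta>>0. \<forall>(n::nat) a b.
        (\<forall>i<n. c \<le> a i \<and> a i \<le> b i \<and> b i \<le> d) \<and>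
        (\<forall>i<n. \<forall>j<n. i \<noteq> j \<longrightarrow> b i \<le> a j \<or> b j \<le> a i) \<and>
        (\<Sum>i<n. b i - a i) < \<delta> \<longrightarrow> (\<Sum>i<n. \<bar>y (b i) - y (a i)\<bar>) < \<epsilon>"
  using assms(1)[unfolded abs_cont_on_def, THEN spec, THEN mp, OF assms(2)] .

text \<open>Enumerating a finite index set reduces to the families over \<open>{..<n}\<close> of the
  definition. The tagged intervals of a division can then be indexed by the division itself.\<close>

lemma abs_cont_on_finite_family:
  assumes "abs_cont_on c d y" "\<epsilon> > 0"
  shows "\<exists>\<delta>>0. \<forall>I a b. finite (I::'i set) \<and> (\<forall>i\<in>I. c \<le> a i \<and> a i \<le> b i \<and> b i \<le> d) \<and>
       (\<forall>i\<in>I. \<forall>j\<in>I. i \<noteq> j \<longrightarrow> b i \<le> a j \<or> b j \<le> a i) \<and>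
       (\<Sum>i\<in>I. b i - a i) < \<delta> \<longrightarrow> (\<Sum>i\<in>I. \<bar>y (b i) - y (a i)\<bar>) < \<epsilon>"
proof -
  from abs_cont_onD[OF assms] obtain \<delta> where "\<delta> > 0" and \<delta>: "\<forall>(n::nat) a b.
        (\<forall>i<n. c \<le> a i \<and> a i \<le> b i \<and> b i \<le> d) \<and>
        (\<forall>i<n. \<forall>j<n. i \<noteq> j \<longrightarrow> b i \<le> a j \<or> b j \<le> a i) \<and>
        (\<Sum>i<n. b i - a i) < \<delta> \<longrightarrow> (\<Sum>i<n. \<bar>y (b i) - y (a i)\<bar>) < \<epsilon>"
    by (elim exE conjE)
  show ?thesis
  proof (intro exI[of _ \<delta>] conjI allI impI)
    fix I :: "'i set" and a b :: "'i \<Rightarrow> real"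
    assume I: "finite I \<and> (\<forall>i\<in>I. c \<le> a i \<and> a i \<le> b i \<and> b i \<le> d) \<and>
       (\<forall>i\<in>I. \<forall>j\<in>I. i \<noteq> j \<longrightarrow> b i \<le> a j \<or> b j \<le> a i) \<and> (\<Sum>i\<in>I. b i - a i) < \<delta>"
    obtain h where h: "bij_betw h {..<card I} I"
      using ex_bij_betw_nat_finite[of I] I by (auto simp: atLeast0LessThan)
    have hI: "h i \<in> I" if "i < card I" for i
      using h that by (auto simp: bij_betw_def)
    have hne: "h i \<noteq> h j" if "i < card I" "j < card I" "i \<noteq> j" for i j
      using h that by (auto simp: bij_betw_def inj_on_def)
    have "(\<Sum>i<card I. b (h i) - a (h i)) < \<delta>"
      using I sum.reindex_bij_betw[OF h, of "\<lambda>i. b i - a i"] by simp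
    moreover have "\<forall>i<card I. \<forall>j<card I. i \<noteq> j \<longrightarrow> b (h i) \<le> a (h j) \<or> b (h j) \<le> a (h i)"
      using I hI hne by simp
    ultimately have "(\<Sum>i<card I. \<bar>y (b (h i)) - y (a (h i))\<bar>) < \<epsilon>"
      using I hI \<delta>[THEN spec, THEN spec, THEN spec, THEN mp, of "card I" "\<lambda>i. a (h i)" "\<lambda>i. b (h i)"]
      by simp
    then show "(\<Sum>i\<in>I. \<bar>y (b i) - y (a i)\<bar>) < \<epsilon>"
      using sum.reindex_bij_betw[OF h, of "\<lambda>i. \<bar>y (b i) - y (a i)\<bar>"] by simp
  qed fact
qed

text \<open>A family short enough for both \<open>y\<close> and \<open>z\<close> is short enough for
  \<open>w\<close>. This one criterion covers products, exponentials and, with the identity as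
  \<open>y\<close>, Lipschitz functions.\<close>

lemma abs_cont_on_dominated:
  assumes y: "abs_cont_on c d y" and z: "abs_cont_on c d z" and "A \<ge> 0" "B \<ge> 0"
    and le: "\<And>u v. c \<le> u \<Longrightarrow> u \<le> v \<Longrightarrow> v \<le> d \<Longrightarrow> \<bar>w v - w u\<bar> \<le> A * \<bar>y v - y u\<bar> + B * \<bar>z v - z u\<bar>"
  shows "abs_cont_on c d w"
  unfolding abs_cont_on_def
proof (intro allI impI)
  fix \<epsilon> :: real assume "\<epsilon> > 0"
  \<comment> \<open>Gives \<open>(A + B) * \<epsilon>' < \<epsilon>\<close>; the summand
    \<open>1\<close> keeps the denominator positive when \<open>A = B = 0\<close>.\<close>
  define \<epsilon>' where "\<epsilon>' = \<epsilon> / (2 * (A + B + 1))"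
  have \<epsilon>': "\<epsilon>' > 0" using \<open>\<epsilon> > 0\<close> \<open>A \<ge> 0\<close> \<open>B \<ge> 0\<close> by (simp add: \<epsilon>'_def)
  from abs_cont_onD[OF y \<epsilon>'] obtain \<delta>1 where "\<delta>1 > 0" and \<delta>1: "\<forall>(n::nat) a b.
        (\<forall>i<n. c \<le> a i \<and> a i \<le> b i \<and> b i \<le> d) \<and>
        (\<forall>i<n. \<forall>j<n. i \<noteq> j \<longrightarrow> b i \<le> a j \<or> b j \<le> a i) \<and>
        (\<Sum>i<n. b i - a i) < \<delta>1 \<longrightarrow> (\<Sum>i<n. \<bar>y (b i) - y (a i)\<bar>) < \<epsilon>'"
    by (elim exE conjE)
  from abs_cont_onD[OF z \<epsilon>'] obtain \<delta>2 where "\<delta>2 > 0" and \<delta>2: "\<forall>(n::nat) a b.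
        (\<forall>i<n. c \<le> a i \<and> a i \<le> b i \<and> b i \<le> d) \<and>
        (\<forall>i<n. \<forall>j<n. i \<noteq> j \<longrightarrow> b i \<le> a j \<or> b j \<le> a i) \<and>
        (\<Sum>i<n. b i - a i) < \<delta>2 \<longrightarrow> (\<Sum>i<n. \<bar>z (b i) - z (a i)\<bar>) < \<epsilon>'"
    by (elim exE conjE)
  show "\<exists>\<delta>>0. \<forall>(n::nat) a b.
        (\<forall>i<n. c \<le> a i \<and> a i \<le> b i \<and> b i \<le> d) \<and>
        (\<forall>i<n. \<forall>j<n. i \<noteq> j \<longrightarrow> b i \<le> a j \<or> b j \<le> a i) \<and>
        (\<Sum>i<n. b i - a i) < \<delta> \<longrightarrow> (\<Sum>i<n. \<bar>w (b i) - w (a i)\<bar>) < \<epsilon>"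
  proof (intro exI[of _ "min \<delta>1 \<delta>2"] conjI allI impI)
    fix n :: nat and a b :: "nat \<Rightarrow> real"
    assume *: "(\<forall>i<n. c \<le> a i \<and> a i \<le> b i \<and> b i \<le> d) \<and>
        (\<forall>i<n. \<forall>j<n. i \<noteq> j \<longrightarrow> b i \<le> a j \<or> b j \<le> a i) \<and>
        (\<Sum>i<n. b i - a i) < min \<delta>1 \<delta>2"
    have 1: "(\<Sum>i<n. \<bar>y (b i) - y (a i)\<bar>) < \<epsilon>'"
      by (rule \<delta>1[THEN spec, THEN spec, THEN spec, THEN mp]) (use * in simp)
    have 2: "(\<Sum>i<n. \<bar>z (b i) - z (a i)\<bar>) < \<epsilon>'"
      by (rule \<delta>2[THEN spec, THEN spec, THEN spec, THEN mp]) (use * in simp)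
    have "(\<Sum>i<n. \<bar>w (b i) - w (a i)\<bar>)
        \<le> (\<Sum>i<n. A * \<bar>y (b i) - y (a i)\<bar> + B * \<bar>z (b i) - z (a i)\<bar>)"
      using * by (intro sum_mono le) auto
    also have "\<dots> = A * (\<Sum>i<n. \<bar>y (b i) - y (a i)\<bar>) + B * (\<Sum>i<n. \<bar>z (b i) - z (a i)\<bar>)"
      by (simp add: sum.distrib sum_distrib_left)
    also have "\<dots> \<le> A * \<epsilon>' + B * \<epsilon>'"
      using 1 2 \<open>A \<ge> 0\<close> \<open>B \<ge> 0\<close> by (intro add_mono mult_left_mono) auto
    also have "\<dots> < (2 * (A + B + 1)) * \<epsilon>'"
      using mult_nonneg_nonneg[OF \<open>A \<ge> 0\<close> less_imp_le[OF \<epsilon>']] mult_nonneg_nonneg[OF \<open>B \<ge> 0\<close> less_imp_le[OF \<epsilon>']] \<epsilon>'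
      by (simp add: algebra_simps)
    also have "\<dots> = \<epsilon>"
      using \<open>A \<ge> 0\<close> \<open>B \<ge> 0\<close> by (simp add: \<epsilon>'_def)
    finally show "(\<Sum>i<n. \<bar>w (b i) - w (a i)\<bar>) < \<epsilon>" .
  qed (use \<open>\<delta>1 > 0\<close> \<open>\<delta>2 > 0\<close> in simp)
qed

lemma abs_cont_on_ident: "abs_cont_on c d (\<lambda>x. x)"
  unfolding abs_cont_on_def by auto

lemma abs_cont_on_imp_continuous_on:
  assumes "abs_cont_on c d y"
  shows "continuous_on {c..d} y"
  unfolding continuous_on_iff
proof (intro ballI allI impI)
  fix x \<epsilon> :: real assume x: "x \<in> {c..d}" and "\<epsilon> > 0"
  from abs_cont_onD[OF assms \<open>\<epsilon> > 0\<close>] obtain \<delta> where "\<delta> > 0" and \<delta>: "\<forall>(n::nat) a b.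
        (\<forall>i<n. c \<le> a i \<and> a i \<le> b i \<and> b i \<le> d) \<and>
        (\<forall>i<n. \<forall>j<n. i \<noteq> j \<longrightarrow> b i \<le> a j \<or> b j \<le> a i) \<and>
        (\<Sum>i<n. b i - a i) < \<delta> \<longrightarrow> (\<Sum>i<n. \<bar>y (b i) - y (a i)\<bar>) < \<epsilon>"
    by (elim exE conjE)
  show "\<exists>\<delta>>0. \<forall>x'\<in>{c..d}. dist x' x < \<delta> \<longrightarrow> dist (y x') (y x) < \<epsilon>"
  proof (intro exI[of _ \<delta>] conjI ballI impI)
    fix x' assume "x' \<in> {c..d}" "dist x' x < \<delta>"
    then have "(\<Sum>i<1::nat. \<bar>y (max x x') - y (min x x')\<bar>) < \<epsilon>"
      by (intro \<delta>[THEN spec, THEN spec, THEN spec, THEN mp])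
        (use x in \<open>auto simp: dist_real_def min_def max_def\<close>)
    then show "dist (y x') (y x) < \<epsilon>"
      by (auto simp: dist_real_def min_def max_def split: if_splits)
  qed fact
qed

text \<open>Riemann sums of the gauge integral are compared with the telescoping sum of the
  increments of \<open>w\<close>, so integrability of \<open>g\<close> comes out together with the
  value. This turns a differential equation that holds almost everywhere into an integral
  formula.\<close>

lemma has_integral_abs_cont_on:
  fixes w g :: "real \<Rightarrow> real"
  assumes "a \<le> b" and ac: "abs_cont_on a b w" and N: "negligible N"
    and deriv: "\<And>x. x \<in> {a..b} - N \<Longrightarrow> (w has_real_derivative g x) (at x within {a..b})"
  shows "(g has_integral (w b - w a)) {a..b}"
proof (cases "a = b")
  case True
  then show ?thesis by (simp add: has_integral_refl)
next
  case False
  with \<open>a \<le> b\<close> have "a < b" by simp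
  \<comment> \<open>The values of \<open>g\<close> on \<open>N\<close> are arbitrary; zero values
    there remove such tags from the Riemann sum, and the spike theorem returns to \<open>g\<close>
    at the end.\<close>
  define h where "h x = (if x \<in> N then 0 else g x)" for x
  have "(h has_integral (w b - w a)) {a..b}"
    unfolding has_integral_factor_content_real
  proof (intro allI impI)
    fix e :: real assume "e > 0"
    \<comment> \<open>The admissible error \<open>e * (b - a)\<close> is halved between the tags in
      \<open>N\<close> and all other tags.\<close>
    then have e0: "e / 2 * (b - a) > 0" using \<open>a < b\<close> by simp
    from abs_cont_on_finite_family[OF ac e0, where 'i = "real \<times> real set"]
    obtain \<delta> where "\<delta> > 0" and \<delta>: "\<forall>I l r. finite (I::(real \<times> real set) set) \<and>
       (\<forall>i\<in>I. a \<le> l i \<and> l i \<le> r i \<and> r i \<le> b) \<and>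
       (\<forall>i\<in>I. \<forall>j\<in>I. i \<noteq> j \<longrightarrow> r i \<le> l j \<or> r j \<le> l i) \<and>
       (\<Sum>i\<in>I. r i - l i) < \<delta> \<longrightarrow> (\<Sum>i\<in>I. \<bar>w (r i) - w (l i)\<bar>) < e / 2 * (b - a)"
      by (elim exE conjE)
    obtain U where U: "open U" "N \<subseteq> U" "U - N \<in> lmeasurable" "emeasure lebesgue (U - N) < ennreal \<delta>"
      using sets_lebesgue_outer_open[OF negligible_imp_sets[OF N] \<open>\<delta> > 0\<close>] by blast
    have N': "N \<in> lmeasurable" "measure lebesgue N = 0"
      using N by (auto simp: negligible_imp_measurable negligible_imp_measure0)
    have Ueq: "U = (U - N) \<union> N" using U by auto
    have Um: "U \<in> lmeasurable" by (subst Ueq) (intro fmeasurable.Un U N')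
    have "measure lebesgue U \<le> measure lebesgue (U - N) + measure lebesgue N"
      by (subst Ueq, rule measure_Un_le) (use U N' in auto)
    also have "\<dots> < \<delta>"
      using U(4) N' \<open>\<delta> > 0\<close> by (simp add: emeasure_eq_measure2[OF U(3)] ennreal_less_iff)
    finally have U\<delta>: "measure lebesgue U < \<delta>" .
    have "\<exists>d>0. x \<in> {a..b} - N \<longrightarrow> (\<forall>y\<in>{a..b}. \<bar>y - x\<bar> < d \<longrightarrow> \<bar>w y - w x - g x * (y - x)\<bar> \<le> e / 2 * \<bar>y - x\<bar>)" for x
    proof (cases "x \<in> {a..b} - N")
      case True
      from deriv[OF this, unfolded has_field_derivative_def has_derivative_within_alt,
          THEN conjunct2, rule_format, OF half_gt_zero[OF \<open>e > 0\<close>]]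
      show ?thesis unfolding real_norm_def by blast
    qed (auto intro: exI[of _ 1])
    then obtain d where d0: "\<And>x. d x > 0" and d: "\<And>x y. x \<in> {a..b} - N \<Longrightarrow> y\<in>{a..b} \<Longrightarrow> \<bar>y - x\<bar> < d x
        \<Longrightarrow> \<bar>w y - w x - g x * (y - x)\<bar> \<le> e / 2 * \<bar>y - x\<bar>"
      by metis
    \<comment> \<open>Intervals tagged in \<open>N\<close> lie in \<open>U\<close>, so absolute continuity controls their increments;
      all others are controlled by the derivative.\<close>
    define \<gamma> where "\<gamma> x = (if x \<in> N then U else ball x (d x))" for x
    have "gauge \<gamma>"
      using U d0 by (auto simp: gauge_def \<gamma>_def)
    have fine_sum: "norm ((\<Sum>(x, K)\<in>p. measure lborel K *\<^sub>R h x) - (w b - w a)) \<le> e * measure lborel {a..b}"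
      if p: "p tagged_division_of {a..b}" "\<gamma> fine p" for p
    proof -
      note pD = tagged_division_ofD[OF p(1)]
      have Kform: "\<exists>u v. K = {u..v} \<and> a \<le> u \<and> u \<le> x \<and> x \<le> v \<and> v \<le> b \<and> Inf K = u \<and> Sup K = v" if "(x, K) \<in> p" for x K
      proof -
        note xK = that
        obtain u v where uv: "K = {u..v}" using pD(4)[OF xK] by auto
        with pD(2,3)[OF xK] show ?thesis
          by (intro exI[of _ u] exI[of _ v]) (auto simp: subset_iff)
      qed
      define l r where "l i = Inf (snd i)" and "r i = Sup (snd i)" for i :: "real \<times> real set"
      \<comment> \<open>Degenerate intervals are left out: they have no increment, and the midpoint
        argument for \<open>Idis\<close> needs nonempty interiors.\<close>
      define I where "I = {i\<in>p. fst i \<in> N \<and> l i < r i}"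
      have Isub: "I \<subseteq> p" and finI: "finite I" using pD(1) by (auto simp: I_def)
      have lr: "a \<le> l i \<and> l i \<le> r i \<and> r i \<le> b \<and> snd i = {l i..r i}" if "i \<in> p" for i
        using Kform[of "fst i" "snd i"] that by (auto simp: l_def r_def)
      have dis: "{l i<..<r i} \<inter> {l j<..<r j} = {}" if "i \<in> p" "j \<in> p" "i \<noteq> j" for i j
      proof -
        have "interior (snd i) \<inter> interior (snd j) = {}"
          using that by (intro pD(5)[of "fst i" _ "fst j"]) (auto simp: prod_eq_iff)
        moreover have "interior (snd i) = {l i<..<r i}" "interior (snd j) = {l j<..<r j}"
          using lr[OF that(1)] lr[OF that(2)] by (simp_all add: interior_atLeastAtMost_real)
        ultimately show ?thesis by blast
      qed
      have IU: "(\<Union>i\<in>I. {l i<..<r i}) \<subseteq> U"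
      proof clarify
        fix i x assume i: "i \<in> I" "x \<in> {l i<..<r i}"
        then have "snd i \<subseteq> \<gamma> (fst i)"
          using p(2) unfolding fine_def I_def by (cases i) auto
        then have "snd i \<subseteq> U" using i(1) by (simp add: \<gamma>_def I_def)
        moreover have "x \<in> snd i" using i lr[of i] Isub by auto
        ultimately show "x \<in> U" by blast
      qed
      have dj: "disjoint_family_on (\<lambda>i. {l i<..<r i}) I"
        unfolding disjoint_family_on_def using dis Isub by blast
      have "(\<Sum>i\<in>I. r i - l i) = (\<Sum>i\<in>I. measure lebesgue {l i<..<r i})"
        using lr Isub by (intro sum.cong) auto
      also have "\<dots> = measure lebesgue (\<Union>i\<in>I. {l i<..<r i})"
      proof (rule measure_finite_Union[symmetric, OF finI _ dj])
        fix i assume "i \<in> I"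
        then show "emeasure lebesgue {l i<..<r i} \<noteq> \<infinity>" by (simp add: I_def)
      qed auto
      also have "\<dots> \<le> measure lebesgue U"
        by (intro measure_mono_fmeasurable IU Um) (use finI in auto)
      finally have Isum: "(\<Sum>i\<in>I. r i - l i) < \<delta>" using U\<delta> by linarith
      have Idis: "\<forall>i\<in>I. \<forall>j\<in>I. i \<noteq> j \<longrightarrow> r i \<le> l j \<or> r j \<le> l i"
      proof (intro ballI impI, rule ccontr)
        fix i j assume ij: "i \<in> I" "j \<in> I" "i \<noteq> j" "\<not> (r i \<le> l j \<or> r j \<le> l i)"
        define m where "m = (max (l i) (l j) + min (r i) (r j)) / 2"
        have "m \<in> {l i<..<r i} \<inter> {l j<..<r j}"
          using ij by (auto simp: m_def I_def max_def min_def field_simps)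
        moreover have "{l i<..<r i} \<inter> {l j<..<r j} = {}" using dis ij Isub by blast
        ultimately show False by blast
      qed
      have B1: "(\<Sum>i\<in>I. \<bar>w (r i) - w (l i)\<bar>) < e / 2 * (b - a)"
        by (rule \<delta>[THEN spec, THEN spec, THEN spec, THEN mp], intro conjI Isum Idis finI) (use lr Isub in blast)
      have cont: "measure lborel (snd i) = r i - l i" if "i \<in> p" for i
        using lr[OF that] by simp
      have est: "\<bar>measure lborel (snd i) * h (fst i) - (w (r i) - w (l i))\<bar>
           \<le> e / 2 * measure lborel (snd i) + (if i \<in> I then \<bar>w (r i) - w (l i)\<bar> else 0)" if i: "i \<in> p" for i
      proof (cases "fst i \<in> N")
        case True
        then show ?thesis
          using i lr[OF i] cont[OF i] \<open>e > 0\<close> by (auto simp: I_def h_def abs_minus_commute[of "w (l i)"])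
      next
        case False
        obtain x K where xK: "i = (x, K)" by (cases i)
        obtain u v where uv: "K = {u..v}" "a \<le> u" "u \<le> x" "x \<le> v" "v \<le> b" "l i = u" "r i = v"
          using Kform[of x K] i xK by (auto simp: l_def r_def)
        have "K \<subseteq> ball x (d x)"
          using fineD[OF p(2), of x K] i xK False by (simp add: \<gamma>_def)
        moreover have "u \<in> K" "v \<in> K" using uv by auto
        ultimately have "u \<in> ball x (d x)" "v \<in> ball x (d x)" by blast+
        then have uv': "\<bar>u - x\<bar> < d x" "\<bar>v - x\<bar> < d x"
          by (auto simp: dist_real_def)
        have x: "x \<in> {a..b} - N" using uv False xK by auto
        have 1: "\<bar>w v - w x - g x * (v - x)\<bar> \<le> e / 2 * (v - x)"
          using d[OF x _ uv'(2)] uv by auto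
        have 2: "\<bar>w u - w x - g x * (u - x)\<bar> \<le> e / 2 * (x - u)"
          using d[OF x _ uv'(1)] uv by auto
        \<comment> \<open>The tag lies between \<open>u\<close> and \<open>v\<close>, so the error
          on \<open>{u..v}\<close> is the difference of the errors from \<open>x\<close> to each
          endpoint, and their bounds add up to the length.\<close>
        have 3: "(v - u) * g x - (w v - w u) = (w u - w x - g x * (u - x)) - (w v - w x - g x * (v - x))"
          by (simp add: algebra_simps)
        have "\<bar>(v - u) * g x - (w v - w u)\<bar> \<le> e / 2 * (v - x) + e / 2 * (x - u)"
          unfolding 3 using 1 2 by linarith
        also have "\<dots> = e / 2 * (v - u)" by (simp add: field_simps)
        finally show ?thesis
          using False uv xK by (simp add: h_def I_def)
      qed
      have "(\<Sum>(x, K)\<in>p. measure lborel K *\<^sub>R h x) - (w b - w a)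
          = (\<Sum>i\<in>p. measure lborel (snd i) * h (fst i)) - (\<Sum>i\<in>p. w (r i) - w (l i))"
        using additive_tagged_division_1[OF \<open>a \<le> b\<close> p(1), of w]
        by (simp add: split_beta l_def r_def)
      also have "\<dots> = (\<Sum>i\<in>p. measure lborel (snd i) * h (fst i) - (w (r i) - w (l i)))"
        by (simp add: sum_subtractf)
      finally have "norm ((\<Sum>(x, K)\<in>p. measure lborel K *\<^sub>R h x) - (w b - w a))
          = \<bar>\<Sum>i\<in>p. measure lborel (snd i) * h (fst i) - (w (r i) - w (l i))\<bar>" by simp
      also have "\<dots> \<le> (\<Sum>i\<in>p. \<bar>measure lborel (snd i) * h (fst i) - (w (r i) - w (l i))\<bar>)"
        by (rule sum_abs)
      also have "\<dots> \<le> (\<Sum>i\<in>p. e / 2 * measure lborel (snd i) + (if i \<in> I then \<bar>w (r i) - w (l i)\<bar> else 0))"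
        by (rule sum_mono) (rule est)
      also have "\<dots> = e / 2 * (\<Sum>i\<in>p. measure lborel (snd i)) + (\<Sum>i\<in>I. \<bar>w (r i) - w (l i)\<bar>)"
        using pD(1) Isub by (simp add: sum.distrib sum_distrib_left sum.inter_restrict[symmetric] Int_absorb1)
      also have "(\<Sum>i\<in>p. measure lborel (snd i)) = b - a"
        using additive_tagged_division_1[OF \<open>a \<le> b\<close> p(1), of "\<lambda>x. x"] cont
        by (simp add: split_beta l_def r_def)
      also have "e / 2 * (b - a) + (\<Sum>i\<in>I. \<bar>w (r i) - w (l i)\<bar>) \<le> e * measure lborel {a..b}"
        using B1 \<open>a < b\<close> by (simp add: field_simps)
      finally show ?thesis .
    qed
    show "\<exists>\<gamma>. gauge \<gamma> \<and> (\<forall>p. p tagged_division_of {a..b} \<and> \<gamma> fine p \<longrightarrow>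
        norm ((\<Sum>(x, K)\<in>p. measure lborel K *\<^sub>R h x) - (w b - w a)) \<le> e * measure lborel {a..b})"
    proof (intro exI[of _ \<gamma>] conjI allI impI)
      fix p assume "p tagged_division_of {a..b} \<and> \<gamma> fine p"
      then show "norm ((\<Sum>(x, K)\<in>p. measure lborel K *\<^sub>R h x) - (w b - w a)) \<le> e * measure lborel {a..b}"
        by (intro fine_sum) simp_all
    qed fact
  qed
  then show ?thesis
    by (rule has_integral_spike[OF N, rotated]) (simp add: h_def)
qed

section \<open>Lebesgue differentiation on the line\<close>

text \<open>The intervals on which the difference quotient is off by more than \<open>1/(k+1)\<close> form a Vitali
  cover of the bad set, and the Henstock lemma bounds the total length of disjoint ones.\<close>

lemma negligible_not_has_derivative_integral:
  fixes f :: "real \<Rightarrow> real"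
  assumes f: "f integrable_on {a..b}"
  shows "negligible {x \<in> {a<..<b}. \<not> ((\<lambda>t. integral {a..t} f) has_real_derivative f x) (at x)}"
proof -
  define bad where "bad k x u v \<longleftrightarrow> a \<le> u \<and> u \<le> x \<and> x \<le> v \<and> v \<le> b \<and> u < v \<and>
      (v - u) / real (Suc k) < \<bar>(v - u) * f x - integral {u..v} f\<bar>" for k :: nat and x u v
  define S where "S k = {x \<in> {a<..<b}. \<forall>d>0. \<exists>u v. bad k x u v \<and> v - u < d}" for k
  have "negligible (S k)" for k
    unfolding negligible_outer_le
  proof (intro allI impI)
    fix e :: real assume "e > 0"
    \<comment> \<open>The Henstock bound is taken smaller by the factor \<open>Suc k\<close>, which
      is lost when lengths are estimated by errors.\<close>
    then have "e / real (Suc k) > 0" by simp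
    from Henstock_lemma[of f a b, unfolded box_real, OF f this]
    obtain \<gamma> where "gauge \<gamma>" and \<gamma>: "\<forall>p. p tagged_partial_division_of {a..b} \<longrightarrow> \<gamma> fine p \<longrightarrow>
        (\<Sum>(x, K)\<in>p. norm (measure lborel K *\<^sub>R f x - integral K f)) < e / real (Suc k)"
      by blast
    \<comment> \<open>Each ball of the Vitali cover keeps its tag: \<open>(x, u, v)\<close> stands
      for \<open>{u..v}\<close> tagged by \<open>x\<close>, while \<open>c\<close> and \<rho>
      present the interval as a closed ball.\<close>
    define X where "X = {(x, u, v). bad k x u v \<and> {u..v} \<subseteq> \<gamma> x}"
    define c where "c = (\<lambda>(x::real, u::real, v::real). (u + v) / 2)"
    define \<rho> where "\<rho> = (\<lambda>(x::real, u::real, v::real). (v - u) / 2)"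
    have cb: "cball (c (x, u, v)) (\<rho> (x, u, v)) = {u..v}" for x u v
      by (auto simp: c_def \<rho>_def cball_eq_atLeastAtMost field_simps)
    have 1: "\<rho> i > 0" if "i \<in> X" for i
      using that by (auto simp: X_def \<rho>_def bad_def)
    have 2: "\<exists>i. i \<in> X \<and> x \<in> cball (c i) (\<rho> i) \<and> \<rho> i < d" if "x \<in> S k" "d > 0" for x d
    proof -
      have "open (\<gamma> x)" "x \<in> \<gamma> x" using \<open>gauge \<gamma>\<close> by (auto simp: gauge_def)
      then obtain r where r: "r > 0" "ball x r \<subseteq> \<gamma> x" by (meson open_contains_ball)
      obtain u v where uv: "bad k x u v" "v - u < min r d"
        using \<open>x \<in> S k\<close>[unfolded S_def, THEN CollectD, THEN conjunct2, rule_format, of "min r d"] r(1) \<open>d > 0\<close> by auto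
      have "{u..v} \<subseteq> ball x r"
        using uv by (auto simp: bad_def dist_real_def)
      then have "(x, u, v) \<in> X" using uv r by (auto simp: X_def)
      moreover have "x \<in> cball (c (x, u, v)) (\<rho> (x, u, v))" "\<rho> (x, u, v) < d"
        using uv unfolding cb by (auto simp: bad_def \<rho>_def)
      ultimately show ?thesis by blast
    qed
    obtain C where C: "countable C" "C \<subseteq> X"
      "pairwise (\<lambda>i j. disjnt (cball (c i) (\<rho> i)) (cball (c j) (\<rho> j))) C"
      "negligible (S k - (\<Union>i\<in>C. cball (c i) (\<rho> i)))"
      by (rule Vitali_covering_theorem_cballs[of X \<rho> "S k" c, OF 1 2])
    let ?V = "\<Union>i\<in>C. cball (c i) (\<rho> i)"
    \<comment> \<open>Henstock's lemma concerns finite divisions, so finite subfamilies are bounded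
      first, uniformly; the bound then passes to the countable union.\<close>
    have bound: "measure lebesgue (\<Union>i\<in>C'. cball (c i) (\<rho> i)) \<le> e" if C': "C' \<subseteq> C" "finite C'" for C'
    proof -
      define \<tau> where "\<tau> = (\<lambda>(x::real, u::real, v::real). (x, {u..v}))"
      have CX: "bad k x u v \<and> {u..v} \<subseteq> \<gamma> x" if "(x, u, v) \<in> C'" for x u v
        using that C' C(2) by (auto simp: X_def)
      have inj: "inj_on \<tau> C'"
        using CX by (fastforce simp: inj_on_def \<tau>_def bad_def)
      have dis: "{u..v} \<inter> {u'..v'} = {}"
        if "(x, u, v) \<in> C'" "(x', u', v') \<in> C'" "(x, u, v) \<noteq> (x', u', v')" for x u v x' u' v'
        
      using pairwiseD[OF C(3), of "(x, u, v)" "(x', u', v')"] that C'(1) unfolding cb disjnt_def by blast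
      have p: "\<tau> ` C' tagged_partial_division_of {a..b}"
        unfolding tagged_partial_division_of_def
      proof (intro conjI allI impI)
        show "finite (\<tau> ` C')" using C' by simp
      next
        fix x K assume "(x, K) \<in> \<tau> ` C'"
        then obtain u v where uv: "(x, u, v) \<in> C'" "K = {u..v}" by (auto simp: \<tau>_def)
        then show "x \<in> K" "K \<subseteq> {a..b}" using CX by (auto simp: bad_def)
        show "\<exists>a b. K = cbox a b" using uv by auto
      next
        fix x K x' K' assume *: "(x, K) \<in> \<tau> ` C' \<and> (x', K') \<in> \<tau> ` C' \<and> (x, K) \<noteq> (x', K')"
        then obtain u v u' v' where "(x, u, v) \<in> C'" "K = {u..v}" "(x', u', v') \<in> C'" "K' = {u'..v'}"
          by (auto simp: \<tau>_def)
        with * dis[of x u v x' u' v'] have "K \<inter> K' = {}" by auto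
        then show "interior K \<inter> interior K' = {}"
          using interior_subset[of K] interior_subset[of K'] by blast
      qed
      have fine: "\<gamma> fine \<tau> ` C'"
        using CX by (auto simp: fine_def \<tau>_def)
      have "measure lebesgue (\<Union>i\<in>C'. cball (c i) (\<rho> i)) \<le> (\<Sum>i\<in>C'. measure lebesgue (cball (c i) (\<rho> i)))"
        by (rule measure_UNION_le) (use C' in auto)
      also have "\<dots> \<le> (\<Sum>i\<in>C'. real (Suc k) * norm (measure lborel (snd (\<tau> i)) *\<^sub>R f (fst (\<tau> i)) - integral (snd (\<tau> i)) f))"
      proof (rule sum_mono)
        fix i assume "i \<in> C'"
        obtain x u v where i: "i = (x, u, v)" by (cases i)
        have "bad k x u v" using CX \<open>i \<in> C'\<close> i by auto
        then have "u < v" and "(v - u) / real (Suc k) < \<bar>(v - u) * f x - integral {u..v} f\<bar>"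
          by (auto simp: bad_def)
        then have "v - u \<le> real (Suc k) * \<bar>(v - u) * f x - integral {u..v} f\<bar>"
          by (simp add: pos_divide_less_eq mult.commute del: of_nat_Suc)
        then show "measure lebesgue (cball (c i) (\<rho> i)) \<le> real (Suc k) * norm (measure lborel (snd (\<tau> i)) *\<^sub>R f (fst (\<tau> i)) - integral (snd (\<tau> i)) f)"
          using \<open>u < v\<close> unfolding i cb by (simp add: \<tau>_def del: of_nat_Suc)
      qed
      also have "\<dots> = real (Suc k) * (\<Sum>(x, K)\<in>\<tau> ` C'. norm (measure lborel K *\<^sub>R f x - integral K f))"
        by (simp add: sum.reindex[OF inj] sum_distrib_left split_beta o_def del: of_nat_Suc)
      also have "\<dots> \<le> real (Suc k) * (e / real (Suc k))"
        using \<gamma>[rule_format, OF p fine] by (intro mult_left_mono) auto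
      also have "\<dots> = e" by simp
      finally show ?thesis .
    qed
    have V: "?V \<in> lmeasurable" "measure lebesgue ?V \<le> e"
      using fmeasurable_UN_bound[OF C(1) _ bound] measure_UN_bound[OF C(1) _ bound] by auto
    have R: "S k - ?V \<in> lmeasurable" "measure lebesgue (S k - ?V) = 0"
      using C(4) by (auto simp: negligible_imp_measurable negligible_imp_measure0)
    show "\<exists>T. S k \<subseteq> T \<and> T \<in> lmeasurable \<and> measure lebesgue T \<le> e"
    proof (intro exI[of _ "(S k - ?V) \<union> ?V"] conjI)
      show "S k - ?V \<union> ?V \<in> lmeasurable" using R V by (intro fmeasurable.Un)
      show "measure lebesgue (S k - ?V \<union> ?V) \<le> e"
        using measure_Un_le[of "S k - ?V" lebesgue ?V] R V fmeasurableD by fastforce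
    qed auto
  qed
  then have "negligible (\<Union>k. S k)" by (intro negligible_countable_Union) auto
  moreover have "{x \<in> {a<..<b}. \<not> ((\<lambda>t. integral {a..t} f) has_real_derivative f x) (at x)} \<subseteq> (\<Union>k. S k)"
  proof (rule subsetI, rule ccontr)
    fix x assume x: "x \<in> {x \<in> {a<..<b}. \<not> ((\<lambda>t. integral {a..t} f) has_real_derivative f x) (at x)}"
      and "x \<notin> (\<Union>k. S k)"
    have ns: "\<exists>d>0. \<forall>u v. v - u < d \<longrightarrow> \<not> bad k x u v" for k
    proof -
      have "x \<notin> S k" using \<open>x \<notin> (\<Union>k. S k)\<close> by blast
      then have "\<not> (\<forall>d>0. \<exists>u v. bad k x u v \<and> v - u < d)" using x by (simp add: S_def)
      then show ?thesis by blast
    qed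
    have F: "integral {a..v} f - integral {a..u} f = integral {u..v} f" if "a \<le> u" "u \<le> v" "v \<le> b" for u v
    proof -
      have "f integrable_on {a..v}" by (rule integrable_subinterval_real[OF f]) (use that in auto)
      from Henstock_Kurzweil_Integration.integral_combine[OF that(1,2) this] show ?thesis by simp
    qed
    have "((\<lambda>t. integral {a..t} f) has_real_derivative f x) (at x)"
      unfolding has_field_derivative_def has_derivative_at_alt
    proof (intro conjI allI impI)
      fix e :: real assume "e > 0"
      obtain k :: nat where k: "inverse (real (Suc k)) < e" using reals_Archimedean[OF \<open>e > 0\<close>] by blast
      obtain d where d: "d > 0" "\<And>u v. v - u < d \<Longrightarrow> \<not> bad k x u v" using ns by blast
      have key: "\<bar>(v - u) * f x - integral {u..v} f\<bar> \<le> e * (v - u)"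
        if "a \<le> u" "u \<le> x" "x \<le> v" "v \<le> b" "u < v" "v - u < d" for u v
      proof -
        have "\<bar>(v - u) * f x - integral {u..v} f\<bar> \<le> (v - u) * inverse (real (Suc k))"
          using d(2)[of v u] that by (auto simp: bad_def not_less divide_inverse)
        also have "\<dots> \<le> (v - u) * e" using k that by (intro mult_left_mono) auto
        finally show ?thesis by (simp add: mult.commute)
      qed
      show "\<exists>d>0. \<forall>y. norm (y - x) < d \<longrightarrow>
          norm (integral {a..y} f - integral {a..x} f - f x * (y - x)) \<le> e * norm (y - x)"
      proof (intro exI[of _ "min d (min (x - a) (b - x))"] conjI allI impI)
        fix y assume y: "norm (y - x) < min d (min (x - a) (b - x))"
        consider "y < x" | "y = x" | "x < y" by linarith
        then show "norm (integral {a..y} f - integral {a..x} f - f x * (y - x)) \<le> e * norm (y - x)"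
        proof cases
          case 1
          then show ?thesis using key[of y x] F[of y x] y x by (auto simp: algebra_simps abs_if split: if_splits)
        next
          case 3
          then show ?thesis using key[of x y] F[of x y] y x by (auto simp: algebra_simps abs_if split: if_splits)
        qed simp
      qed (use d x in auto)
    qed (rule bounded_linear_mult_right)
    with x show False by simp
  qed
  ultimately show ?thesis by (rule negligible_subset)
qed

section \<open>The primitive of the coefficient\<close>

locale nonneg_coefficient =
  fixes q :: "real \<Rightarrow> real"
  assumes nonneg: "\<And>x. q x \<ge> 0" and loc: "loc_integrable q"
begin

text \<open>One of the two intervals is always empty or \<open>{0}\<close>.\<close>

definition prim :: "real \<Rightarrow> real" where
  "prim x = (LINT t:{0..x}|lborel. q t) - (LINT t:{x..0}|lborel. q t)"

lemma set_integrable_q: "set_integrable lborel {u..v} q"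
  using loc by (simp add: loc_integrable_def)

lemma q_integrable_on: "q integrable_on {u..v}"
  by (rule set_borel_integral_eq_integral(1)[OF set_integrable_q])

lemma set_integral_q: "(LINT t:{u..v}|lborel. q t) = integral {u..v} q"
  by (rule set_borel_integral_eq_integral(2)[OF set_integrable_q])

lemma prim_integral: "prim x = integral {0..x} q - integral {x..0} q"
  by (simp only: prim_def set_integral_q)

text \<open>A base point to the left of both \<open>0\<close> and \<open>x\<close> removes the sign
  distinction in \<open>prim\<close> and exhibits it as an indefinite integral up to a
  constant.\<close>

lemma prim_eq:
  assumes "c \<le> 0" "c \<le> x"
  shows "prim x = integral {c..x} q - integral {c..0} q"
proof (cases "x \<ge> 0")
  case True
  have "integral {x..0} q = 0" using True by (cases "x = 0") auto
  then show ?thesis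
    using Henstock_Kurzweil_Integration.integral_combine[of c 0 x q] True assms q_integrable_on
    by (simp add: prim_integral)
next
  case False
  then show ?thesis
    using Henstock_Kurzweil_Integration.integral_combine[of c x 0 q] assms q_integrable_on
    by (simp add: prim_integral)
qed

lemma prim_diff:
  assumes "u \<le> v"
  shows "(LINT t:{u..v}|lborel. q t) = prim v - prim u"
  using prim_eq[of "min u 0" u] prim_eq[of "min u 0" v] assms q_integrable_on
    Henstock_Kurzweil_Integration.integral_combine[of "min u 0" u v q]
  by (simp add: set_integral_q)

lemma prim_mono: "u \<le> v \<Longrightarrow> prim u \<le> prim v"
  using prim_diff[of u v] Henstock_Kurzweil_Integration.integral_nonneg[OF q_integrable_on, of u v] nonneg
  by (simp add: set_integral_q)

text \<open>On each bounded interval \<open>prim\<close> differs by a constant from an integral with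
  fixed lower limit, so Lebesgue differentiation applies there; the exceptional sets form a
  countable union of null sets.\<close>

lemma AE_prim_derivative: "AE x in lborel. (prim has_real_derivative q x) (at x)"
proof -
  define B where "B n = {x \<in> {-real (Suc n)<..<real (Suc n)}.
      \<not> ((\<lambda>t. integral {-real (Suc n)..t} q) has_real_derivative q x) (at x)}" for n
  have "negligible (\<Union>n. B n)"
    unfolding B_def by (intro negligible_countable_Union)
      (auto simp del: of_nat_Suc greaterThanLessThan_iff
        intro!: negligible_not_has_derivative_integral q_integrable_on)
  then have "AE x in lebesgue. x \<notin> (\<Union>n. B n)"
    by (intro AE_not_in) (simp add: negligible_iff_null_sets)
  then have "AE x in lborel. x \<notin> (\<Union>n. B n)"
    by (simp only: AE_completion_iff)
  then show ?thesis
  proof (rule AE_mp, intro AE_I2 impI)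
    fix x assume x: "x \<notin> (\<Union>n. B n)"
    obtain n where "\<bar>x\<bar> < real n" using reals_Archimedean2 by blast
    then have n: "x \<in> {-real (Suc n)<..<real (Suc n)}" by auto
    with x have "((\<lambda>t. integral {-real (Suc n)..t} q) has_real_derivative q x) (at x)"
      by (auto simp: B_def simp del: of_nat_Suc)
    then have "((\<lambda>t. integral {-real (Suc n)..t} q - integral {-real (Suc n)..0} q) has_real_derivative q x) (at x)"
      by (auto intro!: derivative_eq_intros simp del: of_nat_Suc)
    then show "(prim has_real_derivative q x) (at x)"
    proof (rule has_field_derivative_transform_within_open[OF _ open_greaterThanLessThan n])
      fix t assume "t \<in> {- real (Suc n)<..<real (Suc n)}"
      then show "integral {-real (Suc n)..t} q - integral {-real (Suc n)..0} q = prim t"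
        by (intro prim_eq[symmetric]) auto
    qed
  qed
qed

text \<open>On \<open>{c..d}\<close> the coefficient is at most \<open>N\<close> plus a remainder.
  The first part is controlled by the total length of the intervals, the second by its integral over
  the whole line.\<close>

lemma abs_cont_on_prim: "abs_cont_on c d prim"
  unfolding abs_cont_on_def
proof (intro allI impI)
  fix e :: real assume "e > 0"
  \<comment> \<open>Truncating at a level \<open>N\<close> leaves a remainder \<open>r\<close> of small integral.\<close>
  define g where "g t = indicator {c..d} t *\<^sub>R q t" for t
  have g: "integrable lborel g" and g0: "g t \<ge> 0" for t
    using set_integrable_q[of c d] nonneg by (auto simp: g_def[abs_def] set_integrable_def)
  have "(\<lambda>n. \<integral>t. g t - min (g t) (real n) \<partial>lborel) \<longlonglongrightarrow> (\<integral>t. 0 \<partial>(lborel :: real measure))"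
  proof (rule integral_dominated_convergence[where w = g])
    show "AE t in lborel. (\<lambda>n. g t - min (g t) (real n)) \<longlonglongrightarrow> 0"
    proof (intro AE_I2 tendsto_eventually)
      fix t
      obtain N where "g t \<le> real N" using real_arch_simple by blast
      then have "\<And>n. n \<ge> N \<Longrightarrow> g t - min (g t) (real n) = 0" by (simp add: min_def)
      then show "eventually (\<lambda>n. g t - min (g t) (real n) = 0) sequentially"
        by (rule eventually_sequentiallyI)
    qed
  qed (use g g0 in auto)
  then have "\<forall>\<^sub>F n in sequentially. (\<integral>t. g t - min (g t) (real n) \<partial>lborel) < e / 2"
    using \<open>e > 0\<close> by (intro order_tendstoD(2)) auto
  then obtain N where N: "(\<integral>t. g t - min (g t) (real N) \<partial>lborel) < e / 2"
    by (auto simp: eventually_sequentially)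
  define r where "r t = g t - min (g t) (real N)" for t
  have r0: "r t \<ge> 0" for t by (simp add: r_def)
  have [measurable]: "g \<in> borel_measurable borel" using borel_measurable_integrable[OF g] by simp
  have "r \<in> borel_measurable lborel" unfolding r_def[abs_def] by measurable
  then have r: "integrable lborel r"
    by (rule Bochner_Integration.integrable_bound[OF g]) (use g0 in \<open>auto simp: r_def\<close>)
  show "\<exists>\<delta>>0. \<forall>(n::nat) a b.
        (\<forall>i<n. c \<le> a i \<and> a i \<le> b i \<and> b i \<le> d) \<and>
        (\<forall>i<n. \<forall>j<n. i \<noteq> j \<longrightarrow> b i \<le> a j \<or> b j \<le> a i) \<and>
        (\<Sum>i<n. b i - a i) < \<delta> \<longrightarrow> (\<Sum>i<n. \<bar>prim (b i) - prim (a i)\<bar>) < e"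
  \<comment> \<open>With this length the part below level \<open>N\<close> contributes at most
    \<open>e / 2\<close>; \<open>N + 1\<close> allows for \<open>N = 0\<close>.\<close>
  proof (intro exI[of _ "e / (2 * (real N + 1))"] conjI allI impI)
    fix n :: nat and a b :: "nat \<Rightarrow> real"
    assume *: "(\<forall>i<n. c \<le> a i \<and> a i \<le> b i \<and> b i \<le> d) \<and>
        (\<forall>i<n. \<forall>j<n. i \<noteq> j \<longrightarrow> b i \<le> a j \<or> b j \<le> a i) \<and>
        (\<Sum>i<n. b i - a i) < e / (2 * (real N + 1))"
    have ir: "integrable lborel (\<lambda>t. indicator {a i..b i} t * r t)" for i
      using integrable_mult_indicator[OF _ r, of "{a i..b i}"] by simp
    have ii: "integrable lborel (indicator {a i..b i} :: real \<Rightarrow> real)" for i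
      by (rule integrable_real_indicator) (auto simp: emeasure_lborel_Icc_eq)
    have "\<bar>prim (b i) - prim (a i)\<bar> \<le> real N * (b i - a i) + (\<integral>t. indicator {a i..b i} t * r t \<partial>lborel)" if "i < n" for i
    proof -
      have i: "c \<le> a i" "a i \<le> b i" "b i \<le> d" using * that by auto
      have "\<bar>prim (b i) - prim (a i)\<bar> = (\<integral>t. indicator {a i..b i} t * q t \<partial>lborel)"
        using prim_diff[OF i(2)] prim_mono[OF i(2)] by (simp add: set_lebesgue_integral_def)
      also have "\<dots> \<le> (\<integral>t. real N * indicator {a i..b i} t + indicator {a i..b i} t * r t \<partial>lborel)"
      proof (rule integral_mono)
        show "integrable lborel (\<lambda>t. indicator {a i..b i} t * q t)"
          using set_integrable_q[of "a i" "b i"] by (simp add: set_integrable_def)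
        show "integrable lborel (\<lambda>t. real N * indicator {a i..b i} t + indicator {a i..b i} t * r t)"
          by (intro Bochner_Integration.integrable_add integrable_mult_right ii ir)
        show "indicator {a i..b i} t * q t \<le> real N * indicator {a i..b i} t + indicator {a i..b i} t * r t" for t
          using i by (auto simp: r_def g_def indicator_def)
      qed
      also have "\<dots> = real N * (b i - a i) + (\<integral>t. indicator {a i..b i} t * r t \<partial>lborel)"
        using ir ii i by simp
      finally show ?thesis .
    qed
    then have "(\<Sum>i<n. \<bar>prim (b i) - prim (a i)\<bar>)
        \<le> (\<Sum>i<n. real N * (b i - a i) + (\<integral>t. indicator {a i..b i} t * r t \<partial>lborel))"
      by (intro sum_mono) auto
    also have "\<dots> = real N * (\<Sum>i<n. b i - a i) + (\<integral>t. (\<Sum>i<n. indicator {a i..b i} t * r t) \<partial>lborel)"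
      by (simp only: sum.distrib sum_distrib_left Bochner_Integration.integral_sum[OF ir])
    also have "(\<integral>t. (\<Sum>i<n. indicator {a i..b i} t * r t) \<partial>lborel) \<le> (\<integral>t. r t \<partial>lborel)"
    proof (rule integral_mono_AE)
      \<comment> \<open>Distinct intervals may share an endpoint, where the indicators can add up to
        more than one. Off the finitely many endpoints a point lies in at most one interval.\<close>
      have "AE t in lborel. t \<notin> a ` {..<n} \<union> b ` {..<n}"
        by (intro AE_not_in finite_imp_null_set_lborel) auto
      then show "AE t in lborel. (\<Sum>i<n. indicator {a i..b i} t * r t) \<le> r t"
      proof (rule AE_mp, intro AE_I2 impI)
        fix t assume t: "t \<notin> a ` {..<n} \<union> b ` {..<n}"
        have "i = j" if "i < n" "j < n" "t \<in> {a i..b i}" "t \<in> {a j..b j}" for i j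
        proof (rule ccontr)
          assume "i \<noteq> j"
          then have "b i \<le> a j \<or> b j \<le> a i" using * that by blast
          moreover have "t \<noteq> b i" "t \<noteq> b j" using t that by auto
          ultimately show False using that by auto
        qed
        then have "card {i \<in> {..<n}. t \<in> {a i..b i}} \<le> Suc 0"
          by (subst card_le_Suc0_iff_eq) auto
        moreover have "(\<Sum>i<n. indicator {a i..b i} t) = real (card {i \<in> {..<n}. t \<in> {a i..b i}})"
          by (simp add: indicator_def sum.If_cases Int_def)
        ultimately have "(\<Sum>i<n. indicator {a i..b i} t) \<le> (1::real)" by simp
        then show "(\<Sum>i<n. indicator {a i..b i} t * r t) \<le> r t"
          using mult_right_mono[OF _ r0[of t]] by (fastforce simp: sum_distrib_right[symmetric])
      qed
    qed (intro Bochner_Integration.integrable_sum ir r)+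
    also have "(\<integral>t. r t \<partial>lborel) < e / 2" using N by (simp add: r_def)
    also have "real N * (\<Sum>i<n. b i - a i) \<le> real N * (e / (2 * (real N + 1)))"
      using * by (intro mult_left_mono) auto
    also have "\<dots> \<le> e / 2"
      using \<open>e > 0\<close> by (simp add: field_simps)
    finally show "(\<Sum>i<n. \<bar>prim (b i) - prim (a i)\<bar>) < e" by simp
  qed (use \<open>e > 0\<close> in simp)
qed

lemma isCont_prim: "isCont prim x"
  using abs_cont_on_imp_continuous_on[OF abs_cont_on_prim[of "x - 1" "x + 1"]]
  by (rule continuous_on_interior) auto

lemma continuous_on_prim: "continuous_on S prim"
  by (simp add: continuous_at_imp_continuous_on isCont_prim)

end

section \<open>Decay of solutions\<close>

text \<open>The inequality \<open>1 + z \<le> exp z\<close> makes the exponential Lipschitz below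
  any level \<open>c\<close>. This transfers absolute continuity from \<open>prim\<close> to
  exponentials of it.\<close>

lemma abs_exp_diff_le:
  fixes u v :: real
  assumes "u \<le> c" "v \<le> c"
  shows "\<bar>exp v - exp u\<bar> \<le> exp c * \<bar>v - u\<bar>"
proof -
  have *: "exp v - exp u \<le> exp c * (v - u)" if "u \<le> v" "v \<le> c" for u v :: real
  proof -
    have "exp v - exp u = exp v * (1 - exp (u - v))"
      by (simp add: exp_diff algebra_simps)
    also have "\<dots> \<le> exp v * (v - u)"
    proof (rule mult_left_mono)
      show "1 - exp (u - v) \<le> v - u" using exp_ge_add_one_self[of "u - v"] by linarith
    qed simp
    also have "\<dots> \<le> exp c * (v - u)"
      using that by (intro mult_right_mono) auto
    finally show ?thesis .
  qed
  show ?thesis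
    using *[of u v] *[of v u] assms by (cases "u \<le> v") (auto simp: abs_if)
qed

text \<open>Where \<open>\<bar>f t\<bar> > M\<close>, the factor
  \<open>\<bar>f t\<bar> powr (1 - r)\<close> is at most \<open>M powr (1 - r) = \<epsilon>\<close>,
  so \<open>\<bar>f t\<bar>\<close> is at most \<epsilon> times
  \<open>\<bar>f t\<bar> powr r\<close>, whose integral is \<open>1\<close>. The exponent
  \<open>1 - r\<close> is negative because \<open>p > 1\<close>. For \<open>p = \<infinity>\<close>
  the choice \<open>M = 1\<close>, \<open>g = 0\<close> works.\<close>

lemma Lp_unit_ball_dominated:
  assumes "p > 1" "\<epsilon> > 0"
  obtains M where "M \<ge> 0" "\<And>f. in_Lp p f \<Longrightarrow> Lp_norm p f = 1 \<Longrightarrow>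
    \<exists>g. integrable lborel g \<and> (\<forall>t. 0 \<le> g t \<and> \<bar>f t\<bar> \<le> M + g t) \<and> (\<integral>t. g t \<partial>lborel) \<le> \<epsilon>"
proof (cases "p = \<infinity>")
  case True
  show thesis
  proof (rule that[of 1])
    fix f assume f: "in_Lp p f" "Lp_norm p f = 1"
    then have "bounded (range f)" and S: "(SUP x. \<bar>f x\<bar>) = 1"
      using True by (auto simp: in_Lp_def Lp_norm_def)
    then have "bdd_above (range (\<lambda>x. \<bar>f x\<bar>))"
      by (auto simp: bounded_iff bdd_above_def)
    then have "\<bar>f t\<bar> \<le> 1" for t
      using cSUP_upper[of t UNIV "\<lambda>x. \<bar>f x\<bar>"] S by simp
    then show "\<exists>g. integrable lborel g \<and> (\<forall>t. 0 \<le> g t \<and> \<bar>f t\<bar> \<le> 1 + g t) \<and> (\<integral>t. g t \<partial>lborel) \<le> \<epsilon>"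
      using \<open>\<epsilon> > 0\<close> by (intro exI[of _ "\<lambda>_. 0"]) auto
  qed simp
next
  case False
  then obtain r where r: "p = ereal r" "r > 1"
    using \<open>p > 1\<close> by (cases p) auto
  define M where "M = \<epsilon> powr (1 / (1 - r))"
  have M: "M > 0" "M powr (1 - r) = \<epsilon>"
    using \<open>\<epsilon> > 0\<close> r by (auto simp: M_def powr_powr)
  show thesis
  proof (rule that[of M])
    fix f assume f: "in_Lp p f" "Lp_norm p f = 1"
    define I where "I = (\<integral>x. \<bar>f x\<bar> powr r \<partial>lborel)"
    have int: "integrable lborel (\<lambda>x. \<bar>f x\<bar> powr r)" and I1: "I powr (1 / r) = 1"
      using f r by (auto simp: in_Lp_def Lp_norm_def I_def)
    have "I \<ge> 0" unfolding I_def by simp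
    have "I = (I powr (1 / r)) powr r"
      using r \<open>I \<ge> 0\<close> by (simp add: powr_powr)
    then have "I = 1" unfolding I1 by simp
    have "\<bar>f t\<bar> \<le> M + \<epsilon> * \<bar>f t\<bar> powr r" for t
    proof (cases "\<bar>f t\<bar> \<le> M")
      case True
      then show ?thesis using \<open>\<epsilon> > 0\<close> by (simp add: add_increasing2)
    next
      case False
      then have "\<bar>f t\<bar> > 0" using M by linarith
      then have "\<bar>f t\<bar> = \<bar>f t\<bar> powr (1 - r) * \<bar>f t\<bar> powr r"
        by (simp add: powr_add[symmetric])
      also have "\<dots> \<le> M powr (1 - r) * \<bar>f t\<bar> powr r"
        using False M r by (intro mult_right_mono powr_mono2') auto
      finally show ?thesis unfolding M(2) using M(1) by linarith
    qed
    then show "\<exists>g. integrable lborel g \<and> (\<forall>t. 0 \<le> g t \<and> \<bar>f t\<bar> \<le> M + g t) \<and> (\<integral>t. g t \<partial>lborel) \<le> \<epsilon>"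
      using int \<open>I = 1\<close> \<open>\<epsilon> > 0\<close>
      by (intro exI[of _ "\<lambda>t. \<epsilon> * \<bar>f t\<bar> powr r"]) (auto simp: I_def)
  qed (use M in simp)
qed

text \<open>Excludes solutions that blow up to the right: the boundary term at \<open>T\<close> in
  the integral formula can be made small along suitable \<open>T\<close>. For finite
  \<open>p\<close> the bound \<open>1\<close> serves, since \<open>\<bar>y\<bar> > 1\<close> on a
  half-line contradicts integrability.\<close>

lemma in_Lp_bounded_frequently:
  assumes "p > 1" "in_Lp p y"
  obtains R where "\<And>T0. \<exists>T\<ge>T0. \<bar>y T\<bar> \<le> R"
proof (cases "p = \<infinity>")
  case True
  with assms obtain R where "\<And>T. \<bar>y T\<bar> \<le> R"
    by (auto simp: in_Lp_def bounded_iff)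
  then show thesis by (intro that) auto
next
  case False
  then obtain r where r: "p = ereal r" "r > 1"
    using \<open>p > 1\<close> by (cases p) auto
  then have int: "integrable lborel (\<lambda>x. \<bar>y x\<bar> powr r)"
    using assms by (auto simp: in_Lp_def)
  define I where "I = (\<integral>x. \<bar>y x\<bar> powr r \<partial>lborel)"
  have "I \<ge> 0" unfolding I_def by simp
  have "\<exists>T\<ge>T0. \<bar>y T\<bar> \<le> 1" for T0
  proof (rule ccontr)
    assume "\<not> (\<exists>T\<ge>T0. \<bar>y T\<bar> \<le> 1)"
    then have "\<bar>y T\<bar> > 1" if "T \<ge> T0" for T
      using that not_le by blast
    then have ge: "\<bar>y T\<bar> powr r \<ge> 1" if "T \<ge> T0" for T
      using that r by (intro ge_one_powr_ge_zero) (auto intro: less_imp_le)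
    \<comment> \<open>An interval of length \<open>I + 1\<close> beyond \<open>T0\<close> would
      already carry more than the whole integral \<open>I\<close>.\<close>
    have "I + 1 = (\<integral>t. indicator {T0..T0 + (I + 1)} t \<partial>lborel)"
      using \<open>I \<ge> 0\<close> by simp
    also have "\<dots> \<le> (\<integral>x. \<bar>y x\<bar> powr r \<partial>lborel)"
    proof (rule integral_mono[OF _ int])
      show "integrable lborel (indicator {T0..T0 + (I + 1)} :: real \<Rightarrow> real)"
        by (rule integrable_real_indicator) (auto simp: emeasure_lborel_Icc_eq)
    qed (use ge in \<open>auto simp: indicator_def\<close>)
    finally show False by (simp add: I_def)
  qed
  then show thesis by (rule that)
qed

section \<open>Bounds on the kernel and uniform decay\<close>

context nonneg_coefficient
begin

text \<open>Each step of length \<open>2 * a\<close> gains at least \<open>m\<close>; the final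
  \<open>- m\<close> pays for the last incomplete step.\<close>

lemma prim_linear_growth:
  assumes "a > 0" "m \<ge> 0" and gap: "\<And>x. prim (x + 2 * a) - prim x \<ge> m" and "x \<le> s"
  shows "prim s - prim x \<ge> m / (2 * a) * (s - x) - m"
proof -
  have steps: "prim (x + 2 * a * real n) - prim x \<ge> m * real n" for n
  proof (induction n)
    case (Suc n)
    have "x + 2 * a * real (Suc n) = (x + 2 * a * real n) + 2 * a" by (simp add: algebra_simps)
    then show ?case using Suc gap[of "x + 2 * a * real n"] by (simp add: algebra_simps)
  qed simp
  define n where "n = nat \<lfloor>(s - x) / (2 * a)\<rfloor>"
  have n: "real n \<le> (s - x) / (2 * a)" "(s - x) / (2 * a) - 1 \<le> real n"
    using \<open>x \<le> s\<close> \<open>a > 0\<close> by (auto simp: n_def)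
  have "2 * a * real n \<le> s - x"
    using n(1) \<open>a > 0\<close> by (simp add: field_simps)
  then have "prim (x + 2 * a * real n) \<le> prim s" by (intro prim_mono) simp
  moreover have "m * ((s - x) / (2 * a) - 1) \<le> m * real n"
    using n(2) \<open>m \<ge> 0\<close> by (rule mult_left_mono)
  ultimately show ?thesis using steps[of n] by (simp add: algebra_simps)
qed

lemma kernel_integrable: "(\<lambda>s. exp (-(prim s - prim x))) integrable_on {u..v}"
  by (rule integrable_continuous_interval) (intro continuous_intros continuous_on_prim)

text \<open>Linear growth of \<open>prim\<close> bounds the kernel by
  \<open>exp m * exp (- k * (s - x))\<close> with rate \<open>k = m / (2 * a)\<close>, whose
  integral is at most \<open>exp m / k\<close> for all \<open>x\<close> and
  \<open>T\<close>.\<close>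

lemma kernel_integral_le:
  assumes "a > 0" "m > 0" and gap: "\<And>x. prim (x + 2 * a) - prim x \<ge> m" and "x \<le> T"
  shows "integral {x..T} (\<lambda>s. exp (-(prim s - prim x))) \<le> exp m * (2 * a / m)"
proof -
  define k where "k = m / (2 * a)"
  have "k > 0" using assms by (simp add: k_def)
  define F where "F s = - (exp m / k) * exp (- k * (s - x))" for s
  have "((\<lambda>s. exp m * exp (- k * (s - x))) has_integral (F T - F x)) {x..T}"
    by (rule fundamental_theorem_of_calculus[OF \<open>x \<le> T\<close>])
      (use \<open>k > 0\<close> in \<open>auto simp: F_def[abs_def] has_real_derivative_iff_has_vector_derivative[symmetric]
         intro!: derivative_eq_intros\<close>)
  moreover have "exp (-(prim s - prim x)) \<le> exp m * exp (- k * (s - x))" if "s \<in> {x..T}" for s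
    using prim_linear_growth[OF \<open>a > 0\<close> less_imp_le[OF \<open>m > 0\<close>] gap, of x s] that
    by (simp add: mult_exp_exp k_def)
  ultimately have "integral {x..T} (\<lambda>s. exp (-(prim s - prim x))) \<le> F T - F x"
    using has_integral_le[OF integrable_integral[OF kernel_integrable]] by blast
  also have "\<dots> \<le> exp m / k"
    using \<open>k > 0\<close> by (simp add: F_def)
  finally show ?thesis by (simp add: k_def)
qed

text \<open>Up to \<open>x + b\<close> the kernel is at most \<open>1\<close>. Beyond, it is the
  kernel based at \<open>x + b\<close> times a factor of at most \<open>exp (-K)\<close>. Small
  \<open>b\<close> and large \<open>K\<close> make the bound small.\<close>

lemma kernel_integral_le_split:
  assumes "b \<ge> 0" "x \<le> T" and K: "prim (x + b) - prim x \<ge> K"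
    and C: "\<And>x T. x \<le> T \<Longrightarrow> integral {x..T} (\<lambda>s. exp (-(prim s - prim x))) \<le> C"
  shows "integral {x..T} (\<lambda>s. exp (-(prim s - prim x))) \<le> b + exp (-K) * C"
proof -
  have "C \<ge> 0" using C[of 0 0] by simp
  have short: "integral {x..v} (\<lambda>s. exp (-(prim s - prim x))) \<le> v - x" if "x \<le> v" for v
  proof -
    have "integral {x..v} (\<lambda>s. exp (-(prim s - prim x))) \<le> integral {x..v} (\<lambda>s. 1)"
      by (intro integral_le kernel_integrable) (auto simp: prim_mono)
    then show ?thesis using that by simp
  qed
  show ?thesis
  proof (cases "T \<le> x + b")
    case True
    then show ?thesis using short[OF \<open>x \<le> T\<close>] \<open>C \<ge> 0\<close> by (simp add: add_increasing2)
  next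
    case False
    have eq: "exp (-(prim s - prim x)) = exp (-(prim (x + b) - prim x)) * exp (-(prim s - prim (x + b)))" for s
      by (simp add: mult_exp_exp)
    have "integral {x..T} (\<lambda>s. exp (-(prim s - prim x)))
        = integral {x..x + b} (\<lambda>s. exp (-(prim s - prim x))) + integral {x + b..T} (\<lambda>s. exp (-(prim s - prim x)))"
      using False \<open>b \<ge> 0\<close> by (intro Henstock_Kurzweil_Integration.integral_combine[symmetric] kernel_integrable) auto
    also have "integral {x + b..T} (\<lambda>s. exp (-(prim s - prim x)))
        = exp (-(prim (x + b) - prim x)) * integral {x + b..T} (\<lambda>s. exp (-(prim s - prim (x + b))))"
      by (subst eq) simp
    also have "\<dots> \<le> exp (-K) * C"
      using K C[of "x + b" T] False
      by (intro mult_mono integral_nonneg kernel_integrable) auto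
    also have "integral {x..x + b} (\<lambda>s. exp (-(prim s - prim x))) \<le> b"
      using short[of "x + b"] \<open>b \<ge> 0\<close> by simp
    finally show ?thesis by simp
  qed
qed

lemma filterlim_prim_at_top:
  assumes "a > 0" "m > 0" and gap: "\<And>x. prim (x + 2 * a) - prim x \<ge> m"
  shows "filterlim prim at_top at_top"
  unfolding filterlim_at_top
proof
  fix Z
  have "Z \<le> prim s" if "s \<ge> max 0 ((Z + m - prim 0) / (m / (2 * a)))" for s
  proof -
    have "(Z + m - prim 0) / (m / (2 * a)) \<le> s" using that by simp
    then have "Z + m - prim 0 \<le> s * (m / (2 * a))"
      using assms by (subst (asm) pos_divide_le_eq) auto
    then show ?thesis
      using prim_linear_growth[OF \<open>a > 0\<close> less_imp_le[OF \<open>m > 0\<close>] gap, of 0 s] that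
      by (simp add: mult.commute)
  qed
  then show "\<forall>\<^sub>F s in at_top. Z \<le> prim s"
    unfolding eventually_at_top_linorder by blast
qed

text \<open>The integrating factor gives \<open>w\<close> with \<open>w x = y x\<close> and
  derivative \<open>- f t * exp (-(prim t - prim x))\<close> almost everywhere. Integration up to
  \<open>T\<close> leaves a boundary term that vanishes along points where \<open>y\<close> is
  bounded. The kernel is at most \<open>1\<close> to the right of \<open>x\<close>, so
  \<open>g\<close> contributes at most its own integral.\<close>

lemma solution_bound:
  assumes lim: "filterlim prim at_top at_top"
    and y: "loc_abs_cont y" "AE t in lborel. (y has_real_derivative (q t * y t - f t)) (at t)"
    and R: "\<And>T0. \<exists>T\<ge>T0. \<bar>y T\<bar> \<le> R"
    and g: "integrable lborel g" "\<And>t. 0 \<le> g t" "\<And>t. \<bar>f t\<bar> \<le> M + g t" "(\<integral>t. g t \<partial>lborel) \<le> \<eta>"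
    and B: "\<And>T. x \<le> T \<Longrightarrow> integral {x..T} (\<lambda>s. exp (-(prim s - prim x))) \<le> B"
    and "M \<ge> 0"
  shows "\<bar>y x\<bar> \<le> M * B + \<eta>"
proof (rule field_le_epsilon)
  fix e :: real assume "e > 0"
  \<comment> \<open>The double minus matches \<open>filterlim_uminus_at_bot\<close>, which turns the
    claim into divergence of the exponent to minus infinity.\<close>
  have "filterlim (\<lambda>T. - (- (prim T - prim x))) at_top at_top"
    using filterlim_tendsto_add_at_top[OF tendsto_const lim, of "- prim x"] by simp
  then have "((\<lambda>T. R * exp (-(prim T - prim x))) \<longlongrightarrow> R * 0) at_top"
    unfolding filterlim_uminus_at_bot[symmetric]
    by (intro tendsto_mult tendsto_const filterlim_compose[OF exp_at_bot])
  then have "\<forall>\<^sub>F T in at_top. R * exp (-(prim T - prim x)) < e"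
    using \<open>e > 0\<close> by (intro order_tendstoD(2)) auto
  then obtain T0 where T0: "\<And>T. T \<ge> T0 \<Longrightarrow> R * exp (-(prim T - prim x)) < e"
    by (auto simp: eventually_at_top_linorder)
  \<comment> \<open>\<open>T\<close> lies beyond \<open>T0\<close>, where the exponential beats
    \<open>R\<close>, and is one of the points at which
    \<open>\<bar>y T\<bar> \<le> R\<close>.\<close>
  obtain T where T: "T \<ge> max x T0" "\<bar>y T\<bar> \<le> R" using R by blast
  then have "x \<le> T" by simp
  define w where "w t = y t * exp (-(prim t - prim x))" for t
  have acy: "abs_cont_on x T y" using y by (simp add: loc_abs_cont_def)
  have "bounded (y ` {x..T})"
    using abs_cont_on_imp_continuous_on[OF acy] by (intro compact_imp_bounded compact_continuous_image) auto
  then obtain D where "\<forall>t\<in>{x..T}. \<bar>y t\<bar> \<le> D" unfolding bounded_iff by auto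
  then have D: "\<bar>y t\<bar> \<le> D" if "t \<in> {x..T}" for t using that by blast
  have "D \<ge> 0" using D[of x] \<open>x \<le> T\<close> by force
  have acw: "abs_cont_on x T w"
  proof (rule abs_cont_on_dominated[OF acy abs_cont_on_prim, of 1 D])
    fix u v assume uv: "x \<le> u" "u \<le> v" "v \<le> T"
    have "w v - w u = exp (-(prim u - prim x)) * (y v - y u) + y v * (exp (-(prim v - prim x)) - exp (-(prim u - prim x)))"
      by (simp add: w_def algebra_simps)
    also have "\<bar>\<dots>\<bar> \<le> \<bar>exp (-(prim u - prim x)) * (y v - y u)\<bar> + \<bar>y v * (exp (-(prim v - prim x)) - exp (-(prim u - prim x)))\<bar>"
      by (rule abs_triangle_ineq)
    also have "\<bar>exp (-(prim u - prim x)) * (y v - y u)\<bar> \<le> 1 * \<bar>y v - y u\<bar>"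
      unfolding abs_mult using uv prim_mono[of x u] by (intro mult_right_mono) auto
    also have "\<bar>y v * (exp (-(prim v - prim x)) - exp (-(prim u - prim x)))\<bar> \<le> D * \<bar>prim v - prim u\<bar>"
      unfolding abs_mult
      using abs_exp_diff_le[of "-(prim u - prim x)" 0 "-(prim v - prim x)"] uv prim_mono[of x u] prim_mono[of x v] D[of v] \<open>D \<ge> 0\<close>
      by (intro mult_mono) auto
    finally show "\<bar>w v - w u\<bar> \<le> 1 * \<bar>y v - y u\<bar> + D * \<bar>prim v - prim u\<bar>" by simp
  qed (use \<open>D \<ge> 0\<close> in auto)
  have "AE t in lborel. (prim has_real_derivative q t) (at t) \<and> (y has_real_derivative (q t * y t - f t)) (at t)"
    using AE_prim_derivative y(2) by eventually_elim simp
  then obtain N where N: "N \<in> null_sets lborel"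
      "\<And>t. t \<notin> N \<Longrightarrow> (prim has_real_derivative q t) (at t) \<and> (y has_real_derivative (q t * y t - f t)) (at t)"
    by (rule AE_E3) auto
  have "negligible N"
    using N(1) by (simp add: negligible_iff_null_sets null_sets_completionI)
  have hi: "((\<lambda>t. - f t * exp (-(prim t - prim x))) has_integral (w T - w x)) {x..T}"
  proof (rule has_integral_abs_cont_on[OF \<open>x \<le> T\<close> acw \<open>negligible N\<close>])
    fix t assume "t \<in> {x..T} - N"
    then have "(prim has_real_derivative q t) (at t)" "(y has_real_derivative (q t * y t - f t)) (at t)"
      using N(2) by auto
    then have "(w has_real_derivative (- f t * exp (-(prim t - prim x)))) (at t)"
      unfolding w_def[abs_def] by (auto intro!: derivative_eq_intros simp: algebra_simps)
    then show "(w has_real_derivative (- f t * exp (-(prim t - prim x)))) (at t within {x..T})"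
      by (rule has_field_derivative_at_within)
  qed
  have gU: "g integrable_on UNIV" by (rule integrable_on_lborel[OF g(1)])
  have gi: "g integrable_on {x..T}" by (rule integrable_on_subinterval[OF gU]) simp
  have "\<bar>w T - w x\<bar> = norm (integral {x..T} (\<lambda>t. - f t * exp (-(prim t - prim x))))"
    using integral_unique[OF hi] by simp
  also have "\<dots> \<le> integral {x..T} (\<lambda>t. M * exp (-(prim t - prim x)) + g t)"
  proof (rule integral_norm_bound_integral)
    show "(\<lambda>t. M * exp (-(prim t - prim x)) + g t) integrable_on {x..T}"
      using kernel_integrable gi by (intro integrable_add integrable_on_mult_right) auto
    fix t assume t: "t \<in> {x..T}"
    have "norm (- f t * exp (-(prim t - prim x))) \<le> (M + g t) * exp (-(prim t - prim x))"
      using g(3)[of t] by (simp add: abs_mult)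
    also have "\<dots> \<le> M * exp (-(prim t - prim x)) + g t"
      using g(2)[of t] t prim_mono[of x t] by (simp add: distrib_right mult_left_le)
    finally show "norm (- f t * exp (-(prim t - prim x))) \<le> M * exp (-(prim t - prim x)) + g t" .
  qed (rule has_integral_integrable[OF hi])
  also have "\<dots> = M * integral {x..T} (\<lambda>t. exp (-(prim t - prim x))) + integral {x..T} g"
    using kernel_integrable gi by (subst integral_add) (auto intro!: integrable_on_mult_right)
  also have "\<dots> \<le> M * B + \<eta>"
  proof (rule add_mono)
    have "integral {x..T} g \<le> integral UNIV g"
      using g(2) gU gi by (intro integral_subset_le) auto
    also have "\<dots> = (\<integral>t. g t \<partial>lborel)" by (rule integral_lborel[OF g(1)])
    finally show "integral {x..T} g \<le> \<eta>" using g(4) by simp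
  qed (intro mult_left_mono B \<open>x \<le> T\<close> \<open>M \<ge> 0\<close>)
  finally have "\<bar>w T - w x\<bar> \<le> M * B + \<eta>" .
  moreover have "w x = y x" by (simp add: w_def)
  moreover have "\<bar>w T\<bar> \<le> R * exp (-(prim T - prim x))"
    using T(2) by (simp add: w_def abs_mult)
  moreover have "R * exp (-(prim T - prim x)) < e" using T0 T(1) by simp
  ultimately show "\<bar>y x\<bar> \<le> M * B + \<eta> + e" by linarith
qed

text \<open>Half of \<epsilon> goes to the part of \<open>f\<close> that is small in
  \<open>L_1\<close>, half to \<open>M\<close> times the kernel integral. None of the constants in
  the final bound depends on the solution, so the decay is uniform over
  \<open>Dp p q\<close>.\<close>

lemma tend_in_whole_to_zeroI:
  assumes "p > 1" "a > 0" "m > 0" and gap: "\<And>x. prim (x + 2 * a) - prim x \<ge> m"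
    and lim: "\<And>b. b > 0 \<Longrightarrow> filterlim (\<lambda>x. prim (x + b) - prim (x - b)) at_top at_infinity"
  shows "tend_in_whole_to_zero p q"
  unfolding tend_in_whole_to_zero_def
proof (intro allI impI)
  fix \<epsilon> :: real assume "\<epsilon> > 0"
  then have "\<epsilon> / 2 > 0" by simp
  from Lp_unit_ball_dominated[OF \<open>p > 1\<close> this]
  obtain M where "M \<ge> 0" and M: "\<And>f. in_Lp p f \<Longrightarrow> Lp_norm p f = 1 \<Longrightarrow>
    \<exists>g. integrable lborel g \<and> (\<forall>t. 0 \<le> g t \<and> \<bar>f t\<bar> \<le> M + g t) \<and> (\<integral>t. g t \<partial>lborel) \<le> \<epsilon> / 2"
    by blast
  define C where "C = exp m * (2 * a / m)"
  have "C > 0" using assms by (simp add: C_def)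
  note C = kernel_integral_le[OF \<open>a > 0\<close> \<open>m > 0\<close> gap, folded C_def]
  \<comment> \<open>With \<open>2 * b = z\<close> and \<open>exp (-K) * C = z\<close> the kernel
    bound is \<open>2 * z\<close>, and \<open>M * (2 * z) \<le> \<epsilon> / 2\<close>; the summand
    \<open>1\<close> allows for \<open>M = 0\<close>.\<close>
  define z where "z = \<epsilon> / (4 * (M + 1))"
  define b where "b = z / 2"
  define K where "K = - ln (z / C)"
  have "z > 0" using \<open>M \<ge> 0\<close> \<open>\<epsilon> > 0\<close> by (simp add: z_def)
  then have "b > 0" by (simp add: b_def)
  have "exp (-K) * C = z"
    using \<open>z > 0\<close> \<open>C > 0\<close> by (simp add: K_def)
  moreover have "M * z \<le> \<epsilon> / 4"
    using \<open>M \<ge> 0\<close> \<open>\<epsilon> > 0\<close> by (simp add: z_def field_simps)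
  ultimately have MB: "M * (2 * b + exp (-K) * C) \<le> \<epsilon> / 2"
    by (simp add: b_def distrib_left)
  obtain X where X: "\<And>x. \<bar>x\<bar> \<ge> X \<Longrightarrow> K \<le> prim (x + b) - prim (x - b)"
    using lim[OF \<open>b > 0\<close>] by (auto simp: filterlim_at_top eventually_at_infinity)
  show "\<exists>x0. \<forall>y\<in>Dp p q. \<forall>x. x0 \<le> \<bar>x\<bar> \<longrightarrow> \<bar>y x\<bar> \<le> \<epsilon>"
  proof (intro exI[of _ "X + b"] ballI allI impI)
    fix y x assume y: "y \<in> Dp p q" and x: "X + b \<le> \<bar>x\<bar>"
    from y obtain f where f: "in_Lp p f" "Lp_norm p f = 1"
        "AE t in lborel. (y has_real_derivative (q t * y t - f t)) (at t)"
      and "in_Lp p y" "loc_abs_cont y"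
      by (auto simp: Dp_def)
    from M[OF f(1,2)] obtain g where g: "integrable lborel g" "\<And>t. 0 \<le> g t" "\<And>t. \<bar>f t\<bar> \<le> M + g t"
        "(\<integral>t. g t \<partial>lborel) \<le> \<epsilon> / 2" by blast
    obtain R where R: "\<And>T0. \<exists>T\<ge>T0. \<bar>y T\<bar> \<le> R"
      using in_Lp_bounded_frequently[OF \<open>p > 1\<close> \<open>in_Lp p y\<close>] by blast
    \<comment> \<open>\<open>{x..x + 2 * b}\<close> is the window of radius \<open>b\<close> centred
      at \<open>x + b\<close>, and \<open>\<bar>x + b\<bar> \<ge> X\<close> by the margin
      \<open>b\<close> in \<open>X + b\<close>.\<close>
    have "K \<le> prim (x + 2 * b) - prim x"
      using X[of "x + b"] x \<open>b > 0\<close> by (simp add: add.assoc)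
    then have "integral {x..T} (\<lambda>s. exp (-(prim s - prim x))) \<le> 2 * b + exp (-K) * C" if "x \<le> T" for T
      using kernel_integral_le_split[of "2 * b" x T K C] C that \<open>b > 0\<close> by simp
    from solution_bound[OF filterlim_prim_at_top[OF \<open>a > 0\<close> \<open>m > 0\<close> gap] \<open>loc_abs_cont y\<close> f(3) R g this \<open>M \<ge> 0\<close>]
    show "\<bar>y x\<bar> \<le> \<epsilon>" using MB by linarith
  qed
qed

end

section \<open>Compactly supported solutions\<close>

lemma ereal_one_le_cases:
  assumes "(1::ereal) \<le> p"
  obtains "p = \<infinity>" | r where "p = ereal r" "r \<ge> 1"
  using assms by (cases p) auto

text \<open>For finite \<open>p\<close>, \<open>\<bar>f x\<bar> powr r\<close> is dominated by
  \<open>B powr r\<close> on the support interval, which gives membership and the bound. The norm is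
  positive because the set where a continuous function is nonzero is open, and a nonempty open set
  is not null.\<close>

lemma
  fixes f :: "real \<Rightarrow> real"
  assumes "1 \<le> p" and cont: "continuous_on UNIV f" and "u < v"
    and supp: "\<And>x. x \<notin> {u..v} \<Longrightarrow> f x = 0" and bound: "\<And>x. \<bar>f x\<bar> \<le> B"
  shows in_Lp_compact_support: "in_Lp p f"
    and Lp_norm_compact_support_le: "Lp_norm p f \<le> B * (v - u) powr (1 / real_of_ereal p)"
    and Lp_norm_compact_support_pos: "f z \<noteq> 0 \<Longrightarrow> Lp_norm p f > 0"
proof -
  have "B \<ge> 0" using bound[of 0] by simp
  have "in_Lp p f \<and> Lp_norm p f \<le> B * (v - u) powr (1 / real_of_ereal p) \<and> (f z \<noteq> 0 \<longrightarrow> Lp_norm p f > 0)"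
    using \<open>1 \<le> p\<close>
  proof (cases rule: ereal_one_le_cases)
    case 1 \<comment> \<open>here \<open>1 / real_of_ereal \<infinity> = 1 / 0 = 0\<close>, so the bound reads \<open>B\<close>\<close>
    have bdd: "bdd_above (range (\<lambda>x. \<bar>f x\<bar>))" using bound by (auto simp: bdd_above_def)
    have "(SUP x. \<bar>f x\<bar>) \<le> B" by (rule cSUP_least) (use bound in auto)
    moreover have "\<bar>f z\<bar> \<le> (SUP x. \<bar>f x\<bar>)" by (rule cSUP_upper[OF UNIV_I bdd])
    moreover have "bounded (range f)" using bound by (auto simp: bounded_iff)
    ultimately show ?thesis using 1 cont \<open>u < v\<close> by (auto simp: in_Lp_def Lp_norm_def)
  next
    case (2 r)
    have [measurable]: "f \<in> borel_measurable borel"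
      using cont by (simp add: borel_measurable_continuous_onI)
    define I where "I = (\<integral>x. \<bar>f x\<bar> powr r \<partial>lborel)"
    have ii: "integrable lborel (\<lambda>x. B powr r * indicator {u..v} x)"
      by (intro integrable_mult_right integrable_real_indicator) (auto simp: emeasure_lborel_Icc_eq)
    have le: "\<bar>f x\<bar> powr r \<le> B powr r * indicator {u..v} x" for x
      using bound[of x] supp[of x] 2 by (auto simp: indicator_def intro!: powr_mono2)
    have int: "integrable lborel (\<lambda>x. \<bar>f x\<bar> powr r)"
      by (rule Bochner_Integration.integrable_bound[OF ii]) (use le in \<open>auto intro!: AE_I2\<close>)
    have "I \<le> (\<integral>x. B powr r * indicator {u..v} x \<partial>lborel)"
      unfolding I_def by (rule integral_mono[OF int ii le])
    also have "\<dots> = B powr r * (v - u)" using \<open>u < v\<close> by simp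
    finally have "I \<le> B powr r * (v - u)" .
    moreover have "I \<ge> 0" unfolding I_def by simp
    ultimately have "I powr (1 / r) \<le> (B powr r * (v - u)) powr (1 / r)"
      using 2 by (intro powr_mono2) auto
    also have "\<dots> = B * (v - u) powr (1 / r)"
      using 2 \<open>B \<ge> 0\<close> \<open>u < v\<close> by (simp add: powr_mult powr_powr)
    finally have "I powr (1 / r) \<le> B * (v - u) powr (1 / r)" .
    moreover have "I > 0" if "f z \<noteq> 0"
    proof (rule ccontr)
      assume "\<not> I > 0"
      with \<open>I \<ge> 0\<close> have "I = 0" by simp
      then have "AE x in lborel. \<bar>f x\<bar> powr r = 0"
        unfolding I_def using integral_nonneg_eq_0_iff_AE[OF int] by simp
      then have "AE x in lborel. x \<notin> {x. f x \<noteq> 0}" by eventually_elim simp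
      then have "AE x in lebesgue. x \<notin> {x. f x \<noteq> 0}" by (simp only: AE_completion_iff)
      moreover have op: "open {x. f x \<noteq> 0}"
        using open_vimage[OF _ cont, of "-{0}"] by (simp add: vimage_def open_Compl)
      ultimately have "negligible {x. f x \<noteq> 0}"
        by (subst negligible_iff_null_sets, subst AE_iff_null_sets) auto
      then show False using open_not_negligible[OF op] that by blast
    qed
    ultimately show ?thesis
      using 2 int by (auto simp: in_Lp_def Lp_norm_def I_def)
  qed
  then show "in_Lp p f" "Lp_norm p f \<le> B * (v - u) powr (1 / real_of_ereal p)" "f z \<noteq> 0 \<Longrightarrow> Lp_norm p f > 0"
    by auto
qed

lemma Lp_norm_cmult:
  assumes "1 \<le> p" "in_Lp p f" "c > 0"
  shows "Lp_norm p (\<lambda>x. c * f x) = c * Lp_norm p f"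
  using \<open>1 \<le> p\<close>
proof (cases rule: ereal_one_le_cases)
  case 1
  then have "bounded (range f)" using assms by (simp add: in_Lp_def)
  then have bdd: "bdd_above (range (\<lambda>x. \<bar>f x\<bar>))" by (auto simp: bounded_iff bdd_above_def)
  have up: "\<bar>f x\<bar> \<le> (SUP x. \<bar>f x\<bar>)" for x by (rule cSUP_upper[OF UNIV_I bdd])
  have cup: "c * \<bar>f x\<bar> \<le> c * (SUP x. \<bar>f x\<bar>)" for x using up \<open>c > 0\<close> by simp
  have "(SUP x. c * \<bar>f x\<bar>) = c * (SUP x. \<bar>f x\<bar>)"
  proof (rule antisym)
    show "(SUP x. c * \<bar>f x\<bar>) \<le> c * (SUP x. \<bar>f x\<bar>)" by (rule cSUP_least) (use cup in auto)
    have "bdd_above (range (\<lambda>x. c * \<bar>f x\<bar>))" using cup by (auto simp: bdd_above_def)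
    then have "c * \<bar>f x\<bar> \<le> (SUP x. c * \<bar>f x\<bar>)" for x by (rule cSUP_upper[OF UNIV_I])
    then have "\<bar>f x\<bar> \<le> (SUP x. c * \<bar>f x\<bar>) / c" for x using \<open>c > 0\<close> by (simp add: pos_le_divide_eq mult.commute)
    then have "(SUP x. \<bar>f x\<bar>) \<le> (SUP x. c * \<bar>f x\<bar>) / c" by (intro cSUP_least) auto
    then show "c * (SUP x. \<bar>f x\<bar>) \<le> (SUP x. c * \<bar>f x\<bar>)"
      using \<open>c > 0\<close> by (simp add: pos_le_divide_eq mult.commute)
  qed
  then show ?thesis using 1 \<open>c > 0\<close> by (simp add: Lp_norm_def abs_mult)
next
  case (2 r)
  have "(\<integral>x. \<bar>c * f x\<bar> powr r \<partial>lborel) = c powr r * (\<integral>x. \<bar>f x\<bar> powr r \<partial>lborel)"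
    using \<open>c > 0\<close> by (simp add: abs_mult powr_mult)
  then show ?thesis
    using 2 \<open>c > 0\<close> by (simp add: Lp_norm_def powr_mult powr_powr)
qed

lemma in_Lp_cmult:
  assumes "1 \<le> p" "in_Lp p f" "c > 0"
  shows "in_Lp p (\<lambda>x. c * f x)"
  using \<open>1 \<le> p\<close>
proof (cases rule: ereal_one_le_cases)
  case 1
  then show ?thesis
    using assms bounded_scaling[of "range f" c]
    by (auto simp: in_Lp_def image_image intro!: continuous_intros)
next
  case (2 r)
  then show ?thesis
    using assms by (auto simp: in_Lp_def abs_mult powr_mult)
qed

section \<open>A compactly supported bump with continuous derivative\<close>

context
  fixes s b :: real
  assumes b: "b > 0"
begin

text \<open>The truncated parabola is squared so that the derivative stays continuous at
  \<open>s - b\<close> and \<open>s + b\<close>: for \<open>p = \<infinity>\<close> the right-hand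
  side has to be continuous.\<close>

definition bump :: "real \<Rightarrow> real" where
  "bump t = (max 0 (1 - ((t - s) / b)\<^sup>2))\<^sup>2"

definition bump' :: "real \<Rightarrow> real" where
  "bump' t = - (4 * (t - s) / b\<^sup>2) * max 0 (1 - ((t - s) / b)\<^sup>2)"

lemma bump_outside:
  assumes "t \<notin> {s - b<..<s + b}"
  shows "max 0 (1 - ((t - s) / b)\<^sup>2) = 0"
proof -
  have "1 \<le> \<bar>(t - s) / b\<bar>" using assms b by (auto simp: abs_if field_simps)
  then have "1 \<le> ((t - s) / b)\<^sup>2"
    using abs_le_square_iff[of 1 "(t - s) / b"] by simp
  then show ?thesis by simp
qed

lemma bump_inside:
  assumes "t \<in> {s - b<..<s + b}"
  shows "max 0 (1 - ((t - s) / b)\<^sup>2) = 1 - ((t - s) / b)\<^sup>2"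
proof -
  have "\<bar>(t - s) / b\<bar> \<le> 1" using assms b by (auto simp: abs_if field_simps)
  then have "((t - s) / b)\<^sup>2 \<le> 1"
    using abs_le_square_iff[of "(t - s) / b" 1] by simp
  then show ?thesis by simp
qed

lemma bump_le_1: "0 \<le> bump t" "bump t \<le> 1"
  by (auto simp: bump_def intro!: power_le_one)

text \<open>Inside the support the first factor is at most \<open>4 / b\<close> and the second at
  most \<open>1\<close>. The order \<open>1 / b\<close> is what matters: it cancels the length of
  the support when \<open>p = 1\<close>.\<close>

lemma bump'_le: "\<bar>bump' t\<bar> \<le> 4 / b"
proof (cases "t \<in> {s - b<..<s + b}")
  case True
  have "\<bar>4 * (t - s) / b\<^sup>2\<bar> = 4 * \<bar>t - s\<bar> / b\<^sup>2" by (simp only: abs_divide abs_mult abs_power2 abs_numeral)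
  also have "\<dots> \<le> 4 * b / b\<^sup>2"
    using True b by (intro divide_right_mono) auto
  also have "\<dots> = 4 / b" using b by (simp add: power2_eq_square)
  finally have "\<bar>4 * (t - s) / b\<^sup>2\<bar> \<le> 4 / b" .
  then have "\<bar>4 * (t - s) / b\<^sup>2\<bar> * \<bar>max 0 (1 - ((t - s) / b)\<^sup>2)\<bar> \<le> 4 / b * 1"
    by (intro mult_mono) (use b in auto)
  then show ?thesis by (simp add: bump'_def abs_mult)
qed (use b in \<open>simp add: bump'_def bump_outside\<close>)

lemma continuous_bump: "continuous_on S bump" "continuous_on S bump'"
  unfolding bump_def[abs_def] bump'_def[abs_def] using b by (auto intro!: continuous_intros)

text \<open>Away from the two gluing points the bump agrees locally with a polynomial or with zero.
  The gluing points form a null set, which an equation holding almost everywhere may ignore.\<close>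

lemma has_derivative_bump:
  assumes "t \<noteq> s - b" "t \<noteq> s + b"
  shows "(bump has_real_derivative bump' t) (at t)"
proof (cases "t \<in> {s - b<..<s + b}")
  case True
  have "((\<lambda>t. (1 - ((t - s) / b)\<^sup>2)\<^sup>2) has_real_derivative - (4 * (t - s) / b\<^sup>2) * (1 - ((t - s) / b)\<^sup>2)) (at t)"
    using b by (auto intro!: derivative_eq_intros simp: power2_eq_square field_simps)
  then have "((\<lambda>t. (1 - ((t - s) / b)\<^sup>2)\<^sup>2) has_real_derivative bump' t) (at t)"
    by (simp only: bump'_def bump_inside[OF True])
  then show ?thesis
    by (rule has_field_derivative_transform_within_open[OF _ open_greaterThanLessThan True])
      (simp only: bump_def bump_inside)
next
  case False
  have "t \<in> - {s - b..s + b}" using False assms by auto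
  have "((\<lambda>t. 0) has_real_derivative bump' t) (at t)"
    by (simp only: bump'_def bump_outside[OF False] mult_zero_right DERIV_const)
  then show ?thesis
    by (rule has_field_derivative_transform_within_open[of _ _ _ "- {s - b..s + b}"])
      (use False assms bump_outside in \<open>auto simp: bump_def\<close>)
qed

lemma abs_cont_on_bump: "abs_cont_on c d bump"
proof (rule abs_cont_on_dominated[OF abs_cont_on_ident abs_cont_on_ident])
  \<comment> \<open>\<open>L\<close> bounds the distance to \<open>s\<close> over
    \<open>{c..d}\<close>, so \<open>2 * L\<close> bounds one factor of the difference of squares
    and the bump is Lipschitz on \<open>{c..d}\<close>.\<close>
  define L where "L = \<bar>c - s\<bar> + \<bar>d - s\<bar>"
  fix u v assume uv: "c \<le> u" "u \<le> v" "v \<le> d"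
  let ?P = "\<lambda>t. max 0 (1 - ((t - s) / b)\<^sup>2)"
  have P: "0 \<le> ?P t" "?P t \<le> 1" for t by auto
  have "\<bar>bump v - bump u\<bar> = \<bar>?P v - ?P u\<bar> * \<bar>?P v + ?P u\<bar>"
    unfolding bump_def abs_mult[symmetric] by (simp add: power2_eq_square algebra_simps)
  also have "\<dots> \<le> \<bar>?P v - ?P u\<bar> * 2"
    using P[of u] P[of v] by (intro mult_left_mono) linarith+
  also have "\<bar>?P v - ?P u\<bar> \<le> \<bar>((v - s) / b)\<^sup>2 - ((u - s) / b)\<^sup>2\<bar>"
    by (simp add: max_def abs_if)
  also have "((v - s) / b)\<^sup>2 - ((u - s) / b)\<^sup>2 = (v - u) * ((v - s) + (u - s)) / b\<^sup>2"
    using b by (simp add: power2_eq_square field_simps)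
  also have "\<bar>\<dots>\<bar> = \<bar>v - u\<bar> * \<bar>(v - s) + (u - s)\<bar> / b\<^sup>2"
    by (simp add: abs_mult)
  also have "\<dots> \<le> \<bar>v - u\<bar> * (2 * L) / b\<^sup>2"
  proof (intro divide_right_mono mult_left_mono)
    have "\<bar>v - s\<bar> \<le> L" "\<bar>u - s\<bar> \<le> L" unfolding L_def using uv by linarith+
    then show "\<bar>(v - s) + (u - s)\<bar> \<le> 2 * L" by linarith
  qed auto
  finally show "\<bar>bump v - bump u\<bar> \<le> 2 * (2 * (\<bar>c - s\<bar> + \<bar>d - s\<bar>)) / b\<^sup>2 * \<bar>v - u\<bar> + 0 * \<bar>v - u\<bar>"
    by (simp add: L_def algebra_simps)
qed auto

end

section \<open>Test solutions: failure for \<open>p = 1\<close> and necessity of growing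
  windows\<close>

context nonneg_coefficient
begin

text \<open>\<open>E\<close> solves the homogeneous equation, so its cut-off \<open>Y\<close> solves
  the equation with right-hand side \<open>F\<close>. Since \<open>Y s = 1\<close> and the norm of
  \<open>F\<close> is at most \<open>exp K * c\<close>, scaling \<open>F\<close> to norm one leaves
  at least \<open>exp (-K) / c\<close> at \<open>s\<close>.\<close>

lemma exists_solution_bounded_below:
  assumes "1 \<le> p" "b > 0" and K: "prim (s + b) - prim (s - b) \<le> K"
  obtains y where "y \<in> Dp p q" "y s \<ge> exp (-K) / (4 / b * (2 * b) powr (1 / real_of_ereal p))"
proof -
  let ?\<psi> = "bump s b" and ?\<psi>' = "bump' s b"
  define E where "E t = exp (prim t - prim s)" for t
  define Y where "Y t = E t * ?\<psi> t" for t
  define F where "F t = - E t * ?\<psi>' t" for t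
  define c where "c = 4 / b * (2 * b) powr (1 / real_of_ereal p)"
  have "c > 0" using \<open>b > 0\<close> by (simp add: c_def)
  have contE: "continuous_on UNIV E"
    unfolding E_def[abs_def] by (intro continuous_intros continuous_on_prim)
  have contY: "continuous_on UNIV Y" and contF: "continuous_on UNIV F"
    unfolding Y_def[abs_def] F_def[abs_def]
    by (intro continuous_intros contE continuous_bump[OF \<open>b > 0\<close>])+
  have suppY: "Y t = 0" and suppF: "F t = 0" if "t \<notin> {s - b..s + b}" for t
    using that bump_outside[OF \<open>b > 0\<close>, of t s]
    by (auto simp: Y_def F_def bump_def[OF \<open>b > 0\<close>] bump'_def[OF \<open>b > 0\<close>])
  \<comment> \<open>Both \<open>t\<close> and \<open>s\<close> lie in the window, so
    \<open>prim t - prim s\<close> is at most the increment over the whole window.\<close>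
  have E_le: "E t \<le> exp K" if "t \<in> {s - b..s + b}" for t
    using prim_mono[of t "s + b"] prim_mono[of "s - b" s] that K \<open>b > 0\<close> by (simp add: E_def)
  have F_le: "\<bar>F t\<bar> \<le> exp K * (4 / b)" for t
  proof (cases "t \<in> {s - b..s + b}")
    case True
    have "\<bar>F t\<bar> = E t * \<bar>?\<psi>' t\<bar>" by (simp add: F_def abs_mult E_def)
    also have "\<dots> \<le> exp K * (4 / b)"
      by (intro mult_mono E_le[OF True] bump'_le[OF \<open>b > 0\<close>]) auto
    finally show ?thesis .
  qed (use suppF \<open>b > 0\<close> in simp)
  have Y_le: "\<bar>Y t\<bar> \<le> exp K" for t
  proof (cases "t \<in> {s - b..s + b}")
    case True
    have "\<bar>Y t\<bar> = E t * \<bar>?\<psi> t\<bar>" by (simp add: Y_def abs_mult E_def)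
    also have "\<dots> \<le> exp K * 1"
      using bump_le_1[OF \<open>b > 0\<close>] by (intro mult_mono E_le[OF True]) auto
    finally show ?thesis by simp
  qed (use suppY in simp)
  have "s - b < s + b" using \<open>b > 0\<close> by simp
  note cs = \<open>1 \<le> p\<close> contF this suppF F_le
  \<comment> \<open>A point between centre and edge is used because the derivative of the bump
    vanishes at \<open>s\<close> and at both ends.\<close>
  have "F (s + b / 2) \<noteq> 0"
  proof -
    have "((s + b / 2 - s) / b)\<^sup>2 = 1 / 4" using \<open>b > 0\<close> by (simp add: power2_eq_square)
    then show ?thesis using \<open>b > 0\<close> by (simp add: F_def E_def bump'_def[OF \<open>b > 0\<close>])
  qed
  from Lp_norm_compact_support_pos[OF cs this] have N0: "Lp_norm p F > 0" .
  define k where "k = 1 / Lp_norm p F"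
  have "k > 0" using N0 by (simp add: k_def)
  have "Lp_norm p F \<le> exp K * c"
    using Lp_norm_compact_support_le[OF cs] by (simp add: c_def)
  then have "1 / (exp K * c) \<le> k"
    unfolding k_def using N0 by (intro divide_left_mono) auto
  then have kge: "exp (-K) / c \<le> k" by (simp add: exp_minus field_simps)
  have "loc_abs_cont (\<lambda>t. k * Y t)"
    unfolding loc_abs_cont_def
  proof (intro allI)
    fix u v
    define C where "C = exp (prim v - prim s)"
    show "abs_cont_on u v (\<lambda>t. k * Y t)"
    proof (rule abs_cont_on_dominated[OF abs_cont_on_prim abs_cont_on_bump[OF \<open>b > 0\<close>], of "k * C" "k * C"])
      fix x z assume xz: "u \<le> x" "x \<le> z" "z \<le> v"
      have "\<bar>E z - E x\<bar> \<le> C * \<bar>prim z - prim x\<bar>"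
        unfolding E_def C_def using abs_exp_diff_le[of "prim x - prim s" "prim v - prim s" "prim z - prim s"] xz prim_mono[of x v] prim_mono[of z v]
        by simp
      moreover have "E x \<le> C" unfolding E_def C_def using xz prim_mono[of x v] by simp
      moreover have "E z * ?\<psi> z - E x * ?\<psi> x = (E z - E x) * ?\<psi> z + E x * (?\<psi> z - ?\<psi> x)"
        by (simp add: algebra_simps)
      moreover have "\<bar>E z - E x\<bar> * \<bar>?\<psi> z\<bar> \<le> \<bar>E z - E x\<bar> * 1"
        using bump_le_1[OF \<open>b > 0\<close>] by (intro mult_left_mono) auto
      moreover have "\<bar>E x\<bar> * \<bar>?\<psi> z - ?\<psi> x\<bar> \<le> C * \<bar>?\<psi> z - ?\<psi> x\<bar>"
        using \<open>E x \<le> C\<close> by (intro mult_right_mono) (auto simp: E_def)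
      ultimately have "\<bar>Y z - Y x\<bar> \<le> C * \<bar>prim z - prim x\<bar> + C * \<bar>?\<psi> z - ?\<psi> x\<bar>"
        unfolding Y_def using abs_triangle_ineq[of "(E z - E x) * ?\<psi> z" "E x * (?\<psi> z - ?\<psi> x)"]
        by (simp add: abs_mult)
      then have "k * \<bar>Y z - Y x\<bar> \<le> k * (C * \<bar>prim z - prim x\<bar> + C * \<bar>?\<psi> z - ?\<psi> x\<bar>)"
        using \<open>k > 0\<close> by simp
      then show "\<bar>k * Y z - k * Y x\<bar> \<le> k * C * \<bar>prim z - prim x\<bar> + k * C * \<bar>?\<psi> z - ?\<psi> x\<bar>"
        using \<open>k > 0\<close> by (simp add: right_diff_distrib[symmetric] abs_mult distrib_left mult.assoc)
    qed (use \<open>k > 0\<close> in \<open>auto simp: C_def\<close>)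
  qed
  moreover have "in_Lp p (\<lambda>t. k * Y t)"
    by (intro in_Lp_cmult \<open>1 \<le> p\<close> \<open>k > 0\<close>
        in_Lp_compact_support[OF \<open>1 \<le> p\<close> contY \<open>s - b < s + b\<close> suppY Y_le])
  moreover have inF: "in_Lp p F" by (rule in_Lp_compact_support[OF cs])
  then have "in_Lp p (\<lambda>t. k * F t)" by (intro in_Lp_cmult \<open>1 \<le> p\<close> \<open>k > 0\<close>)
  moreover have "Lp_norm p (\<lambda>t. k * F t) = 1"
    using Lp_norm_cmult[OF \<open>1 \<le> p\<close> inF \<open>k > 0\<close>] N0 by (simp add: k_def)
  moreover have "AE t in lborel. ((\<lambda>t. k * Y t) has_real_derivative (q t * (k * Y t) - k * F t)) (at t)"
  proof -
    have "AE t in lborel. t \<notin> {s - b, s + b}"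
      by (intro AE_not_in finite_imp_null_set_lborel) auto
    then show ?thesis using AE_prim_derivative
    proof eventually_elim
      case (elim t)
      then have "(?\<psi> has_real_derivative ?\<psi>' t) (at t)"
        by (intro has_derivative_bump \<open>b > 0\<close>) auto
      with elim(2) show ?case
        unfolding Y_def[abs_def] F_def E_def[abs_def]
        by (auto intro!: derivative_eq_intros simp: algebra_simps)
    qed
  qed
  ultimately have "(\<lambda>t. k * Y t) \<in> Dp p q"
    unfolding Dp_def by blast
  moreover have "k * Y s \<ge> exp (-K) / c"
    using kge by (simp add: Y_def E_def bump_def[OF \<open>b > 0\<close>])
  ultimately show thesis unfolding c_def by (rule that)
qed

text \<open>For \<open>p = 1\<close> the denominator \<open>4 / b * (2 * b)\<close> is
  \<open>8\<close> for every \<open>b\<close>, and continuity of \<open>prim\<close> yields a window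
  around any point with integral at most \<open>1\<close>. Hence at every point some solution is at
  least \<open>exp (-1) / 8\<close>, twice the tolerance used here.\<close>

lemma not_tend_in_whole_to_zero_1: "\<not> tend_in_whole_to_zero 1 q"
proof
  assume "tend_in_whole_to_zero 1 q"
  moreover have "exp (-1) / 16 > (0::real)" by simp
  ultimately obtain X where X: "\<And>y x. y \<in> Dp 1 q \<Longrightarrow> \<bar>x\<bar> \<ge> X \<Longrightarrow> \<bar>y x\<bar> \<le> exp (-1) / 16"
    unfolding tend_in_whole_to_zero_def by blast
  obtain d where d: "d > 0" "\<And>t. \<bar>t - X\<bar> < d \<Longrightarrow> \<bar>prim t - prim X\<bar> < 1 / 2"
    using isCont_prim[of X] unfolding continuous_at_eps_delta dist_real_def
    by (metis half_gt_zero zero_less_one)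
  define b where "b = d / 2"
  have "b > 0" using d by (simp add: b_def)
  have "prim (X + b) - prim (X - b) \<le> 1"
    using d(2)[of "X + b"] d(2)[of "X - b"] d(1) by (auto simp: b_def abs_if split: if_splits)
  then obtain y where y: "y \<in> Dp 1 q" "y X \<ge> exp (-1) / (4 / b * (2 * b) powr (1 / real_of_ereal 1))"
    using exists_solution_bounded_below[of 1 b X 1] \<open>b > 0\<close> by auto
  have "4 / b * (2 * b) powr (1 / real_of_ereal 1) = 8" using \<open>b > 0\<close> by simp
  with y(2) have "y X \<ge> exp (-1) / 8" by (simp only:)
  moreover have "\<bar>y X\<bar> \<le> exp (-1) / 16" using X[OF y(1), of X] by simp
  moreover have "exp (-1) / 16 < exp (-1) / (8::real)" by simp
  ultimately show False by linarith
qed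

text \<open>A far window of integral at most \<open>K\<close> would carry a test solution whose size
  at the centre is bounded below in terms of \<open>K\<close>, \<open>b\<close> and \<open>p\<close>
  alone; half that bound is the \<epsilon> that leads to a contradiction.\<close>

lemma tend_in_whole_to_zeroD:
  assumes "tend_in_whole_to_zero p q" "1 \<le> p" "b > 0"
  shows "filterlim (\<lambda>x. prim (x + b) - prim (x - b)) at_top at_infinity"
  unfolding filterlim_at_top eventually_at_infinity
proof (intro allI)
  fix K
  define \<epsilon> where "\<epsilon> = exp (-K) / (4 / b * (2 * b) powr (1 / real_of_ereal p)) / 2"
  have "\<epsilon> > 0" using \<open>b > 0\<close> by (simp add: \<epsilon>_def)
  with assms(1) obtain X where X: "\<And>y x. y \<in> Dp p q \<Longrightarrow> \<bar>x\<bar> \<ge> X \<Longrightarrow> \<bar>y x\<bar> \<le> \<epsilon>"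
    unfolding tend_in_whole_to_zero_def by blast
  have "K \<le> prim (x + b) - prim (x - b)" if "X \<le> norm x" for x
  proof (rule ccontr)
    assume "\<not> K \<le> prim (x + b) - prim (x - b)"
    then have "prim (x + b) - prim (x - b) \<le> K" by simp
    from exists_solution_bounded_below[OF \<open>1 \<le> p\<close> \<open>b > 0\<close> this]
    obtain y where y: "y \<in> Dp p q" "exp (-K) / (4 / b * (2 * b) powr (1 / real_of_ereal p)) \<le> y x" .
    then have "2 * \<epsilon> \<le> y x" by (simp add: \<epsilon>_def mult.commute)
    moreover have "\<bar>y x\<bar> \<le> \<epsilon>" using X[OF y(1)] that by simp
    ultimately show False using \<open>\<epsilon> > 0\<close> by linarith
  qed
  then show "\<exists>X. \<forall>x. X \<le> norm x \<longrightarrow> K \<le> prim (x + b) - prim (x - b)" by blast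
qed

section \<open>The function \<open>d\<close> and the windows of \<open>q\<close>\<close>

lemma dfun_eq: "dfun q x = Inf {d. d > 0 \<and> prim (x + d) - prim (x - d) = 2}"
  unfolding dfun_def by (rule arg_cong[where f = Inf]) (auto simp: prim_diff)

text \<open>Intermediate value theorem in the radius: the window integral is continuous, zero at
  radius \<open>0\<close> and at least \<open>2\<close> at radius \<open>c\<close>.\<close>

lemma exists_window:
  assumes "c > 0" "prim (x + c) - prim (x - c) \<ge> 2"
  obtains d where "0 < d" "d \<le> c" "prim (x + d) - prim (x - d) = 2"
proof -
  have "\<exists>d\<ge>0. d \<le> c \<and> prim (x + d) - prim (x - d) = 2"
    by (rule IVT') (use assms in \<open>auto intro!: continuous_intros continuous_on_compose2[OF continuous_on_prim[of UNIV]]\<close>)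
  then obtain d where d: "d \<ge> 0" "d \<le> c" "prim (x + d) - prim (x - d) = 2" by blast
  moreover from d have "d \<noteq> 0" by auto
  ultimately show thesis by (intro that[of d]) auto
qed

lemma dfun_nonneg_le:
  assumes "c > 0" "prim (x + c) - prim (x - c) \<ge> 2"
  shows "0 \<le> dfun q x" "dfun q x \<le> c"
proof -
  let ?S = "{d. d > 0 \<and> prim (x + d) - prim (x - d) = 2}"
  obtain d where d: "0 < d" "d \<le> c" "prim (x + d) - prim (x - d) = 2"
    using exists_window[OF assms] by blast
  have "bdd_below ?S" by (rule bdd_belowI[of _ 0]) auto
  then have "Inf ?S \<le> d" using d by (intro cInf_lower) auto
  then show "dfun q x \<le> c" using d by (simp add: dfun_eq)
  show "0 \<le> dfun q x"
    unfolding dfun_eq by (rule cInf_greatest) (use d in auto)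
qed

text \<open>If \<open>dfun q\<close> is small far out, a far window of radius \<open>b\<close> is
  tiled by \<open>n\<close> windows of radius \<open>b / n\<close>, each of integral at least
  \<open>2\<close>. Conversely, integral at least \<open>2\<close> at radius \<open>e / 2\<close>
  forces \<open>dfun q x \<le> e / 2\<close>. The growth given by \<open>gap\<close> makes the set
  in the infimum nonempty; the \<open>Inf\<close> of an empty set would carry no
  information.\<close>

lemma dfun_tendsto_0_iff:
  assumes "a > 0" "m > 0" and gap: "\<And>x. prim (x + 2 * a) - prim x \<ge> m"
  shows "(dfun q \<longlongrightarrow> 0) at_infinity \<longleftrightarrow>
    (\<forall>b>0. filterlim (\<lambda>x. prim (x + b) - prim (x - b)) at_top at_infinity)"
proof (intro iffI allI impI)
  fix b :: real assume lim: "(dfun q \<longlongrightarrow> 0) at_infinity" and "b > 0"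
  show "filterlim (\<lambda>x. prim (x + b) - prim (x - b)) at_top at_infinity"
    unfolding filterlim_at_top eventually_at_infinity
  proof (intro allI)
    fix K :: real
    obtain n :: nat where n: "max 1 K \<le> real n" using real_arch_simple by blast
    then have "n > 0" by (cases n) auto
    define \<delta> where "\<delta> = b / real n"
    have "\<delta> > 0" using \<open>b > 0\<close> \<open>n > 0\<close> by (simp add: \<delta>_def)
    have "\<forall>\<^sub>F x in at_infinity. dfun q x < \<delta>"
      using lim \<open>\<delta> > 0\<close> by (rule order_tendstoD(2))
    then obtain X where X: "\<And>x. X \<le> \<bar>x\<bar> \<Longrightarrow> dfun q x < \<delta>"
      by (auto simp: eventually_at_infinity)
    have window: "prim (x + \<delta>) - prim (x - \<delta>) \<ge> 2" if "X \<le> \<bar>x\<bar>" for x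
    proof -
      let ?S = "{d. d > 0 \<and> prim (x + d) - prim (x - d) = 2}"
      \<comment> \<open>Chosen so that the linear lower bound for the increment over
        \<open>{x - c..x + c}\<close> equals \<open>3\<close>, enough for a window of integral
        \<open>2\<close> inside.\<close>
      define c where "c = 3 * a / m + a"
      have "c > 0" using \<open>a > 0\<close> \<open>m > 0\<close> by (simp add: c_def add_pos_pos)
      have "m / (2 * a) * (x + c - (x - c)) - m = 3"
        using \<open>a > 0\<close> \<open>m > 0\<close> by (simp add: c_def field_simps)
      then have "prim (x + c) - prim (x - c) \<ge> 2"
        using prim_linear_growth[OF \<open>a > 0\<close> less_imp_le[OF \<open>m > 0\<close>] gap, of "x - c" "x + c"] \<open>c > 0\<close>
        by linarith
      then have "?S \<noteq> {}" using exists_window[OF \<open>c > 0\<close>, of x] by auto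
      moreover have "Inf ?S < \<delta>" using X[OF that] by (simp add: dfun_eq)
      ultimately obtain d where d: "d > 0" "prim (x + d) - prim (x - d) = 2" "d < \<delta>"
        using cInf_lessD[of ?S \<delta>] by blast
      then show ?thesis using prim_mono[of "x + d" "x + \<delta>"] prim_mono[of "x - \<delta>" "x - d"] by simp
    qed
    show "\<exists>X. \<forall>x. X \<le> norm x \<longrightarrow> K \<le> prim (x + b) - prim (x - b)"
    proof (intro exI[of _ "X + b"] allI impI)
      fix x :: real assume x: "X + b \<le> norm x"
      have "prim (x - b + 2 * \<delta> * real k) - prim (x - b) \<ge> 2 * real k" if "k \<le> n" for k
        using that
      proof (induction k)
        case (Suc k)
        \<comment> \<open>The centre of the next tile. It stays within \<open>b\<close> of
          \<open>x\<close>, so \<open>\<bar>z\<bar> \<ge> X\<close> by the margin \<open>b\<close>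
          in \<open>X + b\<close>.\<close>
        define z where "z = x - b + 2 * \<delta> * real k + \<delta>"
        have "\<delta> * (2 * real k + 1) \<le> \<delta> * (2 * real n)"
          using Suc.prems \<open>\<delta> > 0\<close> by (intro mult_left_mono) auto
        moreover have "\<delta> * (2 * real n) = 2 * b" using \<open>n > 0\<close> by (simp add: \<delta>_def)
        moreover have "0 \<le> \<delta> * (2 * real k + 1)" using \<open>\<delta> > 0\<close> by simp
        moreover have "z = x - b + \<delta> * (2 * real k + 1)" by (simp add: z_def algebra_simps)
        ultimately have "\<bar>z - x\<bar> \<le> b" by linarith
        then have "X \<le> \<bar>z\<bar>" using x unfolding real_norm_def by linarith
        from window[OF this] have "prim (z + \<delta>) - prim (z - \<delta>) \<ge> 2" .
        moreover have "z + \<delta> = x - b + 2 * \<delta> * real (Suc k)" "z - \<delta> = x - b + 2 * \<delta> * real k"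
          by (simp_all add: z_def algebra_simps)
        ultimately show ?case using Suc by simp
      qed simp
      from this[of n] have "prim (x + b) - prim (x - b) \<ge> 2 * real n"
        using \<open>n > 0\<close> by (simp add: \<delta>_def add.commute)
      then show "K \<le> prim (x + b) - prim (x - b)" using n by linarith
    qed
  qed
next
  assume lim: "\<forall>b>0. filterlim (\<lambda>x. prim (x + b) - prim (x - b)) at_top at_infinity"
  show "(dfun q \<longlongrightarrow> 0) at_infinity"
    unfolding tendsto_iff dist_real_def
  proof (intro allI impI)
    fix e :: real assume "e > 0"
    then have "filterlim (\<lambda>x. prim (x + e / 2) - prim (x - e / 2)) at_top at_infinity"
      using lim by simp
    then have "\<forall>\<^sub>F x in at_infinity. 2 \<le> prim (x + e / 2) - prim (x - e / 2)"
      unfolding filterlim_at_top by blast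
    then show "\<forall>\<^sub>F x in at_infinity. \<bar>dfun q x - 0\<bar> < e"
    proof eventually_elim
      case (elim x)
      then show ?case using dfun_nonneg_le[of "e / 2" x] \<open>e > 0\<close> by simp
    qed
  qed
qed

end

section \<open>Window integrals as increments of the primitive\<close>

theorem theorem1p6:
  fixes q :: "real \<Rightarrow> real"
  assumes q_nonneg: "\<And>x. q x \<ge> 0"
    and q_loc: "loc_integrable q"
    and q_inf: "\<exists>a>0. (INF x. (LINT t:{x-a..x+a}|lborel. q t)) > 0"
  shows "\<not> tend_in_whole_to_zero 1 q \<and>
         (\<forall>p::ereal. p > 1 \<longrightarrow>
           (tend_in_whole_to_zero p q \<longleftrightarrow>
              (\<forall>b>0. filterlim (\<lambda>x. LINT t:{x-b..x+b}|lborel. q t) at_top at_infinity)) \<and>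
           (tend_in_whole_to_zero p q \<longleftrightarrow> ((dfun q) \<longlongrightarrow> 0) at_infinity))"
proof -
  interpret nonneg_coefficient q by unfold_locales (fact q_nonneg q_loc)+
  obtain a where "a > 0" and inf: "(INF x. (LINT t:{x-a..x+a}|lborel. q t)) > 0"
    using q_inf by blast
  define m where "m = (INF x. (LINT t:{x-a..x+a}|lborel. q t))"
  have window: "(LINT t:{x-b..x+b}|lborel. q t) = prim (x + b) - prim (x - b)" if "b > 0" for x b
    using that by (intro prim_diff) simp
  \<comment> \<open>A real infimum is known to be a lower bound only for a family bounded below;
    nonnegativity of \<open>q\<close> provides the bound \<open>0\<close>.\<close>
  have bdd: "bdd_below (range (\<lambda>x. LINT t:{x-a..x+a}|lborel. q t))"
    by (rule bdd_belowI[of _ 0]) (use \<open>a > 0\<close> in \<open>auto simp: window prim_mono\<close>)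
  have gap: "prim (x + 2 * a) - prim x \<ge> m" for x
    using cINF_lower[OF bdd, of "x + a"] window[OF \<open>a > 0\<close>, of "x + a"] by (simp add: m_def add.assoc)
  have "m > 0" using inf by (simp add: m_def)
  have lim_eq: "(\<forall>b>0. filterlim (\<lambda>x. LINT t:{x-b..x+b}|lborel. q t) at_top at_infinity) \<longleftrightarrow>
      (\<forall>b>0. filterlim (\<lambda>x. prim (x + b) - prim (x - b)) at_top at_infinity)"
    by (auto simp: window)
  have tend_iff: "tend_in_whole_to_zero p q \<longleftrightarrow>
      (\<forall>b>0. filterlim (\<lambda>x. prim (x + b) - prim (x - b)) at_top at_infinity)" if "p > 1" for p
    using tend_in_whole_to_zeroI[OF that \<open>a > 0\<close> \<open>m > 0\<close> gap]
      tend_in_whole_to_zeroD[OF _ less_imp_le[OF that]] by blast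
  show ?thesis
  proof (intro conjI allI impI)
    show "\<not> tend_in_whole_to_zero 1 q" by (rule not_tend_in_whole_to_zero_1)
  next
    fix p :: ereal assume "p > 1"
    show "tend_in_whole_to_zero p q \<longleftrightarrow>
        (\<forall>b>0. filterlim (\<lambda>x. LINT t:{x-b..x+b}|lborel. q t) at_top at_infinity)"
      unfolding lim_eq by (rule tend_iff[OF \<open>p > 1\<close>])
    show "tend_in_whole_to_zero p q \<longleftrightarrow> (dfun q \<longlongrightarrow> 0) at_infinity"
      unfolding dfun_tendsto_0_iff[OF \<open>a > 0\<close> \<open>m > 0\<close> gap] by (rule tend_iff[OF \<open>p > 1\<close>])
  qed
qed

end
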